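(* Let $\Delta$ be a thick polar space of finite rank $n\ge3$, let $U,V$ be two opposite singular subspaces of $\Delta$ of projective dimension $n-3$, and let $\Gamma$ be the generalized quadrangle $U^\perp\cap V^\perp$. Then $\Gamma$ is a Moufang quadrangle.
   Context: A point-line geometry is a set of points with a set of lines (subsets of the point set). Points $x,y$ on a common line are collinear, $x\perp y$ (each point is collinear to itself); $x^\perp$ is the set of points collinear to $x$, $P^\perp=\bigcap_{x\in P}x^\perp$. A (non-degenerate) polar space is a point-line geometry in which every line has at least three points and, for every point $x$, $x^\perp$ is a proper subspace (closed under lines meeting it in at least two points, not everything) meeting every line. Singular subspaces are subspaces of pairwise collinear points. Rank $n$: maximal singular subspaces are projective spaces of dimension $n-1$. Thick: every singular subspace of dimension $n-2$ is contained in at least three maximal singular subspaces. Two singular subspaces $U,V$ are opposite if no point of $U$ is collinear to all points of $V$ and no point of $V$ is collinear to all points of $U$. For $U,V$ opposite of dimension $n-3$, the set $U^\perp\cap V^\perp$ with the lines contained in it is a thick generalized quadrangle (polar space of rank 2). Moufang quadrangle. An apartment of a generalized quadrangle $\Gamma$ is an ordinary quadrangle: four points $d,q,u,n$ with $d\perp q\perp u\perp n\perp d$, $d\not\perp u$, $q\not\perp n$, together with the lines $dq,qu,un,nd$. A root of the second kind is $\alpha=\{d,q,dq,dn,qu\}$; its associated group consists of all collineations of $\Gamma$ fixing every point of $dq$ and stabilizing every line through $d$ or $q$. A root of the first kind is $\alpha=\{d,q,n,dq,dn\}$; its associated group consists of all collineations of $\Gamma$ fixing every point of $dq$ and of $dn$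 and stabilizing every line through $d$. $\Gamma$ is a Moufang quadrangle if for every root $\alpha$ of either kind the associated group acts transitively on the set of apartments of $\Gamma$ containing $\alpha$. A collineation is a permutation of points inducing a permutation of lines. *)

theory Defs
  imports Main "HOL-Combinatorics.Permutations"
begin

section \<open>Point-line geometries\<close>

record 'a geometry =
  points :: "'a set"
  lines :: "'a set set"

definition point_line_geometry :: "'a geometry \<Rightarrow> bool" where
  "point_line_geometry G \<longleftrightarrow> (\<forall>l\<in>lines G. l \<subseteq> points G)"

definition collinear :: "'a geometry \<Rightarrow> 'a \<Rightarrow> 'a \<Rightarrow> bool" where
  "collinear G x y \<longleftrightarrow>
     x \<in> points G \<and> y \<in> points G \<and> (x = y \<or> (\<exists>l\<in>lines G. x \<in> l \<and> y \<in> l))"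

definition perp :: "'a geometry \<Rightarrow> 'a \<Rightarrow> 'a set" where
  "perp G x = {y \<in> points G. collinear G x y}"

definition perp_set :: "'a geometry \<Rightarrow> 'a set \<Rightarrow> 'a set" where
  "perp_set G X = {y \<in> points G. \<forall>x\<in>X. y \<in> perp G x}"

definition at_least_three :: "'b set \<Rightarrow> bool" where
  "at_least_three A \<longleftrightarrow> (\<exists>T\<subseteq>A. card T = 3)"

definition subspace :: "'a geometry \<Rightarrow> 'a set \<Rightarrow> bool" where
  "subspace G S \<longleftrightarrow>
     S \<subseteq> points G \<and>
     (\<forall>l\<in>lines G. (\<exists>x\<in>l \<inter> S. \<exists>y\<in>l \<inter> S. x \<noteq> y) \<longrightarrow> l \<subseteq> S)"

definition subspace_span :: "'a geometry \<Rightarrow> 'a set \<Rightarrow> 'a set" where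
  "subspace_span G X = \<Inter> {S. subspace G S \<and> X \<subseteq> S}"

definition induced :: "'a geometry \<Rightarrow> 'a set \<Rightarrow> 'a geometry" where
  "induced G S = \<lparr>points = S, lines = {l \<in> lines G. l \<subseteq> S}\<rparr>"


section \<open>Projective spaces\<close>

text \<open>The last condition is the axiom of Veblen and Young: if the lines $ab$ and $cd$ meet,
  then so do the lines $ac$ and $bd$. The empty space, a single point and a single line are
  allowed.\<close>

definition projective_space :: "'a geometry \<Rightarrow> bool" where
  "projective_space G \<longleftrightarrow>
     point_line_geometry G \<and>
     (\<forall>l\<in>lines G. at_least_three l) \<and>
     (\<forall>x\<in>points G. \<forall>y\<in>points G. x \<noteq> y \<longrightarrow> (\<exists>!l. l \<in> lines G \<and> x \<in> l \<and> y \<in> l)) \<and>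
     (\<forall>a b c d. \<forall>l1\<in>lines G. \<forall>l2\<in>lines G. \<forall>m1\<in>lines G. \<forall>m2\<in>lines G.
        distinct [a, b, c, d] \<and> {a, b} \<subseteq> l1 \<and> {c, d} \<subseteq> l2 \<and> {a, c} \<subseteq> m1 \<and> {b, d} \<subseteq> m2 \<and>
        l1 \<inter> l2 \<noteq> {} \<longrightarrow> m1 \<inter> m2 \<noteq> {})"

text \<open>Projective dimension: one less than the minimal size of a generating set (so the empty
  space has dimension $-1$).\<close>

definition has_dimension :: "'a geometry \<Rightarrow> int \<Rightarrow> bool" where
  "has_dimension G d \<longleftrightarrow>
     (\<exists>B\<subseteq>points G. finite B \<and> subspace_span G B = points G \<and> int (card B) = d + 1 \<and>
        (\<forall>C\<subseteq>points G. finite C \<and> subspace_span G C = points G \<longrightarrow> card B \<le> card C))"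


section \<open>Polar spaces\<close>

definition polar_space :: "'a geometry \<Rightarrow> bool" where
  "polar_space G \<longleftrightarrow>
     point_line_geometry G \<and>
     (\<forall>l\<in>lines G. at_least_three l) \<and>
     (\<forall>x\<in>points G. subspace G (perp G x) \<and> perp G x \<noteq> points G \<and>
        (\<forall>l\<in>lines G. perp G x \<inter> l \<noteq> {}))"

definition singular_subspace :: "'a geometry \<Rightarrow> 'a set \<Rightarrow> bool" where
  "singular_subspace G S \<longleftrightarrow> subspace G S \<and> (\<forall>x\<in>S. \<forall>y\<in>S. collinear G x y)"

definition maximal_singular_subspace :: "'a geometry \<Rightarrow> 'a set \<Rightarrow> bool" where
  "maximal_singular_subspace G M \<longleftrightarrow>
     singular_subspace G M \<and> (\<forall>S. singular_subspace G S \<and> M \<subseteq> S \<longrightarrow> S = M)"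

definition polar_space_of_rank :: "nat \<Rightarrow> 'a geometry \<Rightarrow> bool" where
  "polar_space_of_rank n G \<longleftrightarrow>
     polar_space G \<and>
     (\<forall>M. maximal_singular_subspace G M \<longrightarrow>
        projective_space (induced G M) \<and> has_dimension (induced G M) (int n - 1))"

definition thick_polar_space_of_rank :: "nat \<Rightarrow> 'a geometry \<Rightarrow> bool" where
  "thick_polar_space_of_rank n G \<longleftrightarrow>
     polar_space_of_rank n G \<and>
     (\<forall>S. singular_subspace G S \<and> has_dimension (induced G S) (int n - 2) \<longrightarrow>
        at_least_three {M. maximal_singular_subspace G M \<and> S \<subseteq> M})"

definition opposite :: "'a geometry \<Rightarrow> 'a set \<Rightarrow> 'a set \<Rightarrow> bool" where
  "opposite G U V \<longleftrightarrow>
     singular_subspace G U \<and> singular_subspace G V \<and>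
     \<not> (\<exists>x\<in>U. \<forall>y\<in>V. collinear G x y) \<and> \<not> (\<exists>y\<in>V. \<forall>x\<in>U. collinear G y x)"


section \<open>Moufang quadrangles\<close>

definition generalized_quadrangle :: "'a geometry \<Rightarrow> bool" where
  "generalized_quadrangle G \<longleftrightarrow> polar_space_of_rank 2 G"

text \<open>Collineations are the identity outside the point set, so that equality of collineations
  is equality of functions.\<close>

definition collineation :: "'a geometry \<Rightarrow> ('a \<Rightarrow> 'a) \<Rightarrow> bool" where
  "collineation G g \<longleftrightarrow> g permutes points G \<and> bij_betw ((`) g) (lines G) (lines G)"

text \<open>Only used for distinct collinear points of a polar space, where the joining line is
  unique.\<close>

definition line_through :: "'a geometry \<Rightarrow> 'a \<Rightarrow> 'a \<Rightarrow> 'a set" where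
  "line_through G x y = (THE l. l \<in> lines G \<and> x \<in> l \<and> y \<in> l)"

text \<open>The four points are automatically pairwise distinct, since collinearity is reflexive.\<close>

definition ordinary_quadrangle :: "'a geometry \<Rightarrow> 'a \<Rightarrow> 'a \<Rightarrow> 'a \<Rightarrow> 'a \<Rightarrow> bool" where
  "ordinary_quadrangle G d q u n \<longleftrightarrow>
     {d, q, u, n} \<subseteq> points G \<and>
     collinear G d q \<and> collinear G q u \<and> collinear G u n \<and> collinear G n d \<and>
     \<not> collinear G d u \<and> \<not> collinear G q n"

text \<open>Apartments and roots consist of points and lines; they are represented by the pair of
  their set of points and their set of lines.\<close>

type_synonym 'a figure = "'a set \<times> 'a set set"

definition figure_contains :: "'a figure \<Rightarrow> 'a figure \<Rightarrow> bool" where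
  "figure_contains A R \<longleftrightarrow> fst R \<subseteq> fst A \<and> snd R \<subseteq> snd A"

definition figure_image :: "('a \<Rightarrow> 'a) \<Rightarrow> 'a figure \<Rightarrow> 'a figure" where
  "figure_image g A = (g ` fst A, (`) g ` snd A)"

definition apartments :: "'a geometry \<Rightarrow> 'a figure set" where
  "apartments G =
     {({d, q, u, n},
       {line_through G d q, line_through G q u, line_through G u n, line_through G n d})
      | d q u n. ordinary_quadrangle G d q u n}"

definition root1 :: "'a geometry \<Rightarrow> 'a \<Rightarrow> 'a \<Rightarrow> 'a \<Rightarrow> 'a figure" where
  "root1 G d q n = ({d, q, n}, {line_through G d q, line_through G d n})"

definition root_group1 :: "'a geometry \<Rightarrow> 'a \<Rightarrow> 'a \<Rightarrow> 'a \<Rightarrow> ('a \<Rightarrow> 'a) set" where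
  "root_group1 G d q n =
     {g. collineation G g \<and>
         (\<forall>x \<in> line_through G d q \<union> line_through G d n. g x = x) \<and>
         (\<forall>l\<in>lines G. d \<in> l \<longrightarrow> g ` l = l)}"

definition root2 :: "'a geometry \<Rightarrow> 'a \<Rightarrow> 'a \<Rightarrow> 'a \<Rightarrow> 'a \<Rightarrow> 'a figure" where
  "root2 G d q u n = ({d, q}, {line_through G d q, line_through G d n, line_through G q u})"

definition root_group2 :: "'a geometry \<Rightarrow> 'a \<Rightarrow> 'a \<Rightarrow> ('a \<Rightarrow> 'a) set" where
  "root_group2 G d q =
     {g. collineation G g \<and>
         (\<forall>x \<in> line_through G d q. g x = x) \<and>
         (\<forall>l\<in>lines G. d \<in> l \<or> q \<in> l \<longrightarrow> g ` l = l)}"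

definition transitive_on_apartments ::
  "'a geometry \<Rightarrow> ('a \<Rightarrow> 'a) set \<Rightarrow> 'a figure \<Rightarrow> bool" where
  "transitive_on_apartments G H R \<longleftrightarrow>
     (\<forall>A\<in>apartments G. \<forall>B\<in>apartments G.
        figure_contains A R \<and> figure_contains B R \<longrightarrow> (\<exists>g\<in>H. figure_image g A = B))"

definition moufang_quadrangle :: "'a geometry \<Rightarrow> bool" where
  "moufang_quadrangle G \<longleftrightarrow>
     generalized_quadrangle G \<and>
     (\<forall>d q u n. ordinary_quadrangle G d q u n \<longrightarrow>
        transitive_on_apartments G (root_group1 G d q n) (root1 G d q n) \<and>
        transitive_on_apartments G (root_group2 G d q) (root2 G d q u n))"

end

theory Submission
  imports Defs
begin

text \<open>Choosing non-collinear points $a \in U$, $b \in V$, the points collinear to $a$ and $b$ form a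
  thick polar space of rank $n - 1$ in which $U \cap b^\perp$ and $V \cap a^\perp$ are opposite with the
  same common perp; iterating, we may assume that $n = 3$, $U = \{a\}$ and $V = \{b\}$.

  For non-collinear points $p, p'$, sending a line through $p$ to the line through $p'$ that meets it is
  an isomorphism of residues. Root elations are obtained by going round a path
  $a \to c \to b \to c' \to a$ with $c, c'$ not collinear to $a, b$. Such a round trip fixes
  every point of $\Gamma$ collinear to $c$ and $c'$; and if a point $q \in \Gamma$ is collinear to $c, c'$, then
  its action on the lines of $\Gamma$ through $q$ depends only on the lines $qc$ and $qc'$, and is
  trivial if these coincide. For a root of the first kind a single round trip
  with $c' \in dc$ suffices. For a root of the second kind we compose two round trips
  through $c_1, c_1'$ and $c_2', c_2$ where $d c_1 = d c_1'$, $d c_2 = d c_2'$,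
  $q c_1 = q c_2$ and $q c_1' = q c_2'$: on the lines through $d$ both are trivial, and on those
  through $q$ they are mutually inverse.\<close>

section \<open>Collinearity, lines and the axiom of Pasch\<close>

text \<open>Let \<open>q\<close> be collinear to \<open>a\<close> and \<open>b\<close>. The
  perspectivity from \<open>a\<close> to \<open>b\<close> then acts on the lines through
  \<open>q\<close>, and this action sees only the lines \<open>q a\<close> and \<open>q b\<close>:
  every centre may be replaced by another point of its line through \<open>q\<close>. The proof of
  this principle is Pasch in the planes through \<open>q\<close>. If \<open>c\<close> and
  \<open>c'\<close> lie on one line through \<open>q\<close>, then \<open>c'\<close> may be replaced
  by \<open>c\<close>, and the path retraces itself. This criterion cannot make one round trip with
  \<open>c \<noteq> c'\<close> trivial at both \<open>d\<close> and \<open>q\<close>: two points on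
  a common line through \<open>d\<close> and on a common line through \<open>q\<close> would lie on
  \<open>d q\<close> and be collinear to \<open>a\<close>. Hence the quadrilateral
  \<open>c1\<close>, \<open>c2\<close>, \<open>c2'\<close>, \<open>c1'\<close> with one pair of
  opposite sides through \<open>q\<close> and the other through \<open>d\<close>. Transitivity
  prescribes source and target, so the centres have to be constructed from the target.\<close>

lemma projective_line_unique:
  assumes "projective_space P" "x \<in> points P" "y \<in> points P" "x \<noteq> y"
    "l \<in> lines P" "x \<in> l" "y \<in> l" "m \<in> lines P" "x \<in> m" "y \<in> m"
  shows "l = m"
proof -
  have "\<exists>!l. l \<in> lines P \<and> x \<in> l \<and> y \<in> l"
    using assms(1-4) unfolding projective_space_def by blast
  then show ?thesis using assms by blast
qed

lemma projective_veblen: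
  assumes "projective_space P" "l1 \<in> lines P" "l2 \<in> lines P" "m1 \<in> lines P" "m2 \<in> lines P"
    "distinct [a, b, c, d]" "{a, b} \<subseteq> l1" "{c, d} \<subseteq> l2" "{a, c} \<subseteq> m1" "{b, d} \<subseteq> m2" "l1 \<inter> l2 \<noteq> {}"
  shows "m1 \<inter> m2 \<noteq> {}"
  using assms(1) unfolding projective_space_def
  by (elim conjE) (erule allE[of _ a], erule allE[of _ b], erule allE[of _ c], erule allE[of _ d],
      use assms in blast)

locale ranked_polar_space =
  fixes G :: "'a geometry" and rk :: nat
  assumes rank: "polar_space_of_rank rk G"
begin

abbreviation col (infix "\<sim>" 50) where "x \<sim> y \<equiv> collinear G x y"
abbreviation ln where "ln \<equiv> line_through G"

text \<open>Closure under lines is not demanded, so that finite configurations and unions of chains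
  qualify.\<close>

definition clique :: "'a set \<Rightarrow> bool" where
  "clique X \<longleftrightarrow> X \<subseteq> points G \<and> (\<forall>x\<in>X. \<forall>y\<in>X. x \<sim> y)"

lemma polar: "polar_space G"
  using rank by (simp add: polar_space_of_rank_def)

lemma line_sub: "l \<in> lines G \<Longrightarrow> l \<subseteq> points G"
  using polar by (auto simp: polar_space_def point_line_geometry_def)

lemma line_three: "l \<in> lines G \<Longrightarrow> at_least_three l"
  using polar by (auto simp: polar_space_def)

lemma third_point:
  assumes "l \<in> lines G" shows "\<exists>z\<in>l. z \<noteq> x \<and> z \<noteq> y"
proof -
  obtain T where T: "T \<subseteq> l" "card T = 3"
    using line_three[OF assms] by (auto simp: at_least_three_def)
  have "card {x, y} \<le> 2" by (simp add: card_insert_if)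
  then have "\<not> T \<subseteq> {x, y}"
    using card_mono[of "{x, y}" T] T(2) by auto
  then show ?thesis using T by auto
qed

lemma col_sym: "x \<sim> y \<Longrightarrow> y \<sim> x"
  by (auto simp: collinear_def)

lemma col_refl: "x \<in> points G \<Longrightarrow> x \<sim> x"
  by (auto simp: collinear_def)

lemma col_pts: "x \<sim> y \<Longrightarrow> x \<in> points G \<and> y \<in> points G"
  by (auto simp: collinear_def)

lemma mem_perp: "y \<in> perp G x \<longleftrightarrow> x \<sim> y"
  by (auto simp: perp_def collinear_def)

lemma line_col: "l \<in> lines G \<Longrightarrow> x \<in> l \<Longrightarrow> y \<in> l \<Longrightarrow> x \<sim> y"
  using line_sub by (auto simp: collinear_def)

lemma perp_subspace: "x \<in> points G \<Longrightarrow> subspace G (perp G x)"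
  using polar by (auto simp: polar_space_def)

lemma col_line:
  assumes "z \<sim> x" "z \<sim> y" "x \<noteq> y" "l \<in> lines G" "x \<in> l" "y \<in> l" "w \<in> l"
  shows "z \<sim> w"
proof -
  have "subspace G (perp G z)" using assms(1) perp_subspace col_pts by blast
  then have "l \<subseteq> perp G z"
    using assms unfolding subspace_def by (meson IntI mem_perp)
  then show ?thesis using assms(7) mem_perp by blast
qed

lemma perp_meets: "x \<in> points G \<Longrightarrow> l \<in> lines G \<Longrightarrow> \<exists>z\<in>l. x \<sim> z"
proof -
  assume "x \<in> points G" "l \<in> lines G"
  then have "perp G x \<inter> l \<noteq> {}" using polar by (auto simp: polar_space_def)
  then show ?thesis using mem_perp by blast
qed

lemma ex_not_col: "x \<in> points G \<Longrightarrow> \<exists>y\<in>points G. \<not> x \<sim> y"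
proof -
  assume "x \<in> points G"
  then have "perp G x \<noteq> points G" using polar by (auto simp: polar_space_def)
  moreover have "perp G x \<subseteq> points G" by (auto simp: perp_def)
  ultimately obtain y where "y \<in> points G" "y \<notin> perp G x" by blast
  then show ?thesis using mem_perp by blast
qed

lemma singular_clique: "singular_subspace G S \<Longrightarrow> clique S"
  by (auto simp: singular_subspace_def clique_def subspace_def)

lemma subspace_line:
  "subspace G S \<Longrightarrow> l \<in> lines G \<Longrightarrow> x \<in> l \<Longrightarrow> y \<in> l \<Longrightarrow> x \<in> S \<Longrightarrow> y \<in> S \<Longrightarrow> x \<noteq> y \<Longrightarrow> l \<subseteq> S"
  unfolding subspace_def by (metis IntI)

text \<open>Zorn's lemma is applied to cliques rather than to singular subspaces. A maximal clique
  contains every point collinear to all of it, and a line with two points in it consists of such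
  points, so it is a singular subspace.\<close>

lemma clique_in_maximal:
  assumes "clique X"
  shows "\<exists>M. maximal_singular_subspace G M \<and> X \<subseteq> M"
proof -
  let ?A = "{Y. clique Y \<and> X \<subseteq> Y}"
  have "\<exists>M\<in>?A. \<forall>Y\<in>?A. M \<subseteq> Y \<longrightarrow> Y = M"
  proof (rule subset_Zorn_nonempty)
    show "?A \<noteq> {}" using assms by blast
    fix C assume C: "C \<noteq> {}" "subset.chain ?A C"
    have "clique (\<Union> C)" unfolding clique_def
    proof (intro conjI ballI)
      show "\<Union> C \<subseteq> points G" using C(2) by (auto simp: subset.chain_def clique_def)
      fix x y assume "x \<in> \<Union> C" "y \<in> \<Union> C"
      then obtain P Q where "P \<in> C" "Q \<in> C" "x \<in> P" "y \<in> Q" by blast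
      moreover then have "P \<subseteq> Q \<or> Q \<subseteq> P" using C(2) unfolding subset.chain_def by blast
      ultimately have "\<exists>R\<in>C. x \<in> R \<and> y \<in> R" by blast
      then show "x \<sim> y" using C(2) by (auto simp: subset.chain_def clique_def)
    qed
    moreover have "X \<subseteq> \<Union> C" using C unfolding subset.chain_def by blast
    ultimately show "\<Union> C \<in> ?A" by simp
  qed
  then obtain M where M: "clique M" "X \<subseteq> M" and mx: "\<And>Y. clique Y \<Longrightarrow> M \<subseteq> Y \<Longrightarrow> Y = M"
    by (metis (mono_tags, lifting) mem_Collect_eq order_trans)
  have closed: "z \<in> M" if z: "z \<in> points G" "\<And>x. x \<in> M \<Longrightarrow> z \<sim> x" for z
  proof -
    have "clique (insert z M)"
      using z M(1) col_sym col_refl unfolding clique_def by blast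
    then show ?thesis using mx by blast
  qed
  have "subspace G M" unfolding subspace_def
  proof (intro conjI ballI impI subsetI)
    fix x assume "x \<in> M" then show "x \<in> points G" using M(1) clique_def by auto
  next
    fix l z assume l: "l \<in> lines G" "\<exists>x\<in>l \<inter> M. \<exists>y\<in>l \<inter> M. x \<noteq> y" and "z \<in> l"
    then obtain x y where "x \<in> l" "x \<in> M" "y \<in> l" "y \<in> M" "x \<noteq> y" by blast
    have "z \<sim> w" if "w \<in> M" for w
    proof -
      have "w \<sim> x" "w \<sim> y" using M(1) that \<open>x \<in> M\<close> \<open>y \<in> M\<close> unfolding clique_def by auto
      then have "w \<sim> z" using col_line \<open>x \<noteq> y\<close> l(1) \<open>x \<in> l\<close> \<open>y \<in> l\<close> \<open>z \<in> l\<close> by blast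
      then show ?thesis by (rule col_sym)
    qed
    then show "z \<in> M" using closed line_sub l(1) \<open>z \<in> l\<close> by blast
  qed
  then have "singular_subspace G M" using M(1) by (auto simp: singular_subspace_def clique_def)
  then show ?thesis
    using M mx singular_clique unfolding maximal_singular_subspace_def by blast
qed

lemma maximal_closed:
  assumes "maximal_singular_subspace G M" "z \<in> points G" "\<And>x. x \<in> M \<Longrightarrow> z \<sim> x"
  shows "z \<in> M"
proof -
  have cl: "clique M" using assms(1) singular_clique unfolding maximal_singular_subspace_def by blast
  have "clique (insert z M)"
    using cl assms(2,3) col_sym col_refl unfolding clique_def by blast
  then obtain N where "maximal_singular_subspace G N" "insert z M \<subseteq> N"
    using clique_in_maximal by blast
  then show ?thesis using assms(1) unfolding maximal_singular_subspace_def by blast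
qed

lemma maximal_projective: "maximal_singular_subspace G M \<Longrightarrow> projective_space (induced G M)"
  using rank by (simp add: polar_space_of_rank_def)

lemma clique_lines_projective:
  assumes "clique X"
  obtains M where "projective_space (induced G M)" "X \<subseteq> M" "subspace G M"
  using clique_in_maximal[OF assms] maximal_projective
  unfolding maximal_singular_subspace_def singular_subspace_def by blast

text \<open>Uniqueness of joining lines is inherited from the projective space on a maximal singular
  subspace through both points, which contains both lines as well.\<close>

lemma line_unique:
  assumes "l \<in> lines G" "m \<in> lines G" "x \<in> l" "y \<in> l" "x \<in> m" "y \<in> m" "x \<noteq> y"
  shows "l = m"
proof -
  have "clique {x, y}" using assms(1,3,4) line_col line_sub unfolding clique_def by blast
  then obtain M where M: "projective_space (induced G M)" "{x, y} \<subseteq> M" "subspace G M"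
    by (rule clique_lines_projective)
  have "l \<subseteq> M" "m \<subseteq> M" using subspace_line[OF M(3), of _ x y] assms M(2) by auto
  then have "l \<in> lines (induced G M)" "m \<in> lines (induced G M)" "x \<in> points (induced G M)"
    "y \<in> points (induced G M)"
    using assms(1,2) M(2) by (auto simp: induced_def)
  then show ?thesis using projective_line_unique[OF M(1)] assms by blast
qed

lemma ln_eqI:
  assumes "l \<in> lines G" "x \<in> l" "y \<in> l" "x \<noteq> y" shows "ln x y = l"
  unfolding line_through_def
proof (rule the_equality)
  show "m = l" if "m \<in> lines G \<and> x \<in> m \<and> y \<in> m" for m
    by (rule line_unique[of m l x y]) (use that assms in simp_all)
qed (use assms in simp)

lemma ln:
  assumes "x \<sim> y" "x \<noteq> y"
  shows ln_line: "ln x y \<in> lines G" and ln_left: "x \<in> ln x y" and ln_right: "y \<in> ln x y"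
proof -
  obtain l where l: "l \<in> lines G" "x \<in> l" "y \<in> l"
    using assms by (auto simp: collinear_def)
  then have "ln x y = l" using assms(2) by (rule ln_eqI)
  then show "ln x y \<in> lines G" "x \<in> ln x y" "y \<in> ln x y" using l by simp_all
qed

lemma ln_sym: "ln x y = ln y x"
  unfolding line_through_def by (simp add: conj_commute)

lemma ln_cong:
  assumes "x \<sim> y" "x \<noteq> y" "z \<in> ln x y" "z \<noteq> x" shows "ln x z = ln x y"
  using ln_eqI[OF ln_line[OF assms(1,2)] ln_left[OF assms(1,2)] assms(3)] assms(4) by simp

lemma ln_swap:
  assumes "x \<sim> y" "x \<noteq> y" "z \<in> ln x y" "z \<noteq> x" shows "y \<in> ln x z"
  using ln_cong[OF assms] ln_right[OF assms(1,2)] by simp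

lemma ln_col:
  assumes "x \<sim> y" "x \<noteq> y" "z \<in> ln x y" "w \<in> ln x y" shows "z \<sim> w"
  using line_col[OF ln_line[OF assms(1,2)] assms(3,4)] .

lemma col_ln:
  assumes "z \<sim> x" "z \<sim> y" "x \<sim> y" "x \<noteq> y" "w \<in> ln x y" shows "z \<sim> w"
  using col_line[OF assms(1,2,4) ln[OF assms(3,4)] assms(5)] .

lemma col_ln':
  assumes "z \<sim> x" "z \<sim> w" "x \<sim> y" "x \<noteq> y" "w \<in> ln x y" "w \<noteq> x" shows "z \<sim> y"
  using col_line[OF assms(1,2) assms(6)[symmetric] ln_line[OF assms(3,4)] ln_left[OF assms(3,4)] assms(5)
    ln_right[OF assms(3,4)]] .

lemma ln_perp_unique:
  assumes "x \<sim> y" "x \<noteq> y" "\<not> b \<sim> x" "z \<in> ln x y" "w \<in> ln x y" "b \<sim> z" "b \<sim> w"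
  shows "z = w"
  using col_line[OF assms(6,7) _ ln_line[OF assms(1,2)] assms(4,5) ln_left[OF assms(1,2)]] assms(3) by blast

text \<open>The four points lie in a common maximal singular subspace, where the axiom of Veblen and
  Young applies. That axiom speaks of four distinct points; in the coincidences \<open>a = d\<close>
  and \<open>b = c\<close> left open here the two lines visibly share a point.\<close>

lemma pasch:
  assumes cl: "clique {a, b, c, d}" and ne: "a \<noteq> b" "c \<noteq> d" "a \<noteq> c" "b \<noteq> d"
    and v: "v \<in> ln a b" "v \<in> ln c d"
  shows "\<exists>w. w \<in> ln a c \<and> w \<in> ln b d"
proof (cases "a = d \<or> b = c")
  case True
  have "a \<sim> c" "b \<sim> d" using cl unfolding clique_def by auto
  then show ?thesis using True ln ne by blast
next
  case False
  obtain M where M: "projective_space (induced G M)" "{a, b, c, d} \<subseteq> M" "subspace G M"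
    using cl by (rule clique_lines_projective)
  have cols: "a \<sim> b" "c \<sim> d" "a \<sim> c" "b \<sim> d" using cl unfolding clique_def by auto
  have L: "ln x y \<in> lines (induced G M) \<and> {x, y} \<subseteq> ln x y" if "x \<sim> y" "x \<noteq> y" "x \<in> M" "y \<in> M" for x y
  proof -
    note l = ln[OF that(1,2)]
    have "ln x y \<subseteq> M" by (rule subspace_line[OF M(3) l that(3,4,2)])
    then show ?thesis using l by (simp add: induced_def)
  qed
  have mem: "a \<in> M" "b \<in> M" "c \<in> M" "d \<in> M" using M(2) by auto
  note Ls = L[OF cols(1) ne(1) mem(1,2)] L[OF cols(2) ne(2) mem(3,4)]
    L[OF cols(3) ne(3) mem(1,3)] L[OF cols(4) ne(4) mem(2,4)]
  have "ln a c \<inter> ln b d \<noteq> {}"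
    by (rule projective_veblen[OF M(1), of "ln a b" "ln c d" "ln a c" "ln b d" a b c d])
      (use Ls v ne False in auto)
  then show ?thesis by blast
qed

end

section \<open>Perspectivities between residues\<close>

context ranked_polar_space begin

definition opp :: "'a \<Rightarrow> 'a \<Rightarrow> bool" where
  "opp x y \<longleftrightarrow> x \<in> points G \<and> y \<in> points G \<and> \<not> x \<sim> y"

definition quad :: "'a \<Rightarrow> 'a \<Rightarrow> 'a set" where
  "quad a b = {x. a \<sim> x \<and> b \<sim> x}"

text \<open>The perspectivity from \<open>a\<close> to \<open>b\<close>, with lines through \<open>a\<close> represented by any of their
  points other than \<open>a\<close>; meaningful only if \<open>a\<close> and \<open>b\<close> are not collinear and \<open>x\<close> is a
  point collinear to \<open>a\<close> and different from it.\<close>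

definition foot :: "'a \<Rightarrow> 'a \<Rightarrow> 'a \<Rightarrow> 'a" where
  "foot a b x = (THE z. z \<in> ln a x \<and> b \<sim> z)"

lemma opp_sym: "opp a b \<Longrightarrow> opp b a"
  using col_sym unfolding opp_def by blast

lemma quad_sym: "quad a b = quad b a"
  by (auto simp: quad_def)

lemma quad_neq: "opp a b \<Longrightarrow> x \<in> quad a b \<Longrightarrow> x \<noteq> a \<and> x \<noteq> b"
  using col_sym unfolding opp_def quad_def by blast

lemma foot_eqI:
  assumes "opp a b" "a \<sim> x" "a \<noteq> x" "z \<in> ln a x" "b \<sim> z"
  shows "foot a b x = z"
  unfolding foot_def
proof (rule the_equality)
  have nb: "\<not> b \<sim> a" using assms(1) col_sym unfolding opp_def by blast
  show "w = z" if "w \<in> ln a x \<and> b \<sim> w" for w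
    using ln_perp_unique[OF assms(2,3) nb, of w z] that assms(4,5) by simp
qed (use assms in simp)

lemma foot_spec:
  assumes "opp a b" "a \<sim> x" "a \<noteq> x"
  shows foot_mem: "foot a b x \<in> ln a x" and foot_perp: "b \<sim> foot a b x"
proof -
  obtain z where z: "z \<in> ln a x" "b \<sim> z"
    using perp_meets[OF _ ln_line[OF assms(2,3)], of b] assms(1) unfolding opp_def by blast
  then have "foot a b x = z" by (rule foot_eqI[OF assms])
  then show "foot a b x \<in> ln a x" "b \<sim> foot a b x" using z by simp_all
qed

lemma foot_quad:
  assumes "opp a b" "a \<sim> x" "a \<noteq> x"
  shows "foot a b x \<in> quad a b"
  using foot_perp[OF assms] foot_mem[OF assms] ln_col[OF assms(2,3)] ln_left[OF assms(2,3)]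
  unfolding quad_def by blast

lemma foot_fix: "opp a b \<Longrightarrow> x \<in> quad a b \<Longrightarrow> foot a b x = x"
  using quad_neq[of a b x] by (intro foot_eqI) (auto simp: quad_def intro: ln_right)

lemma foot_perp_of:
  assumes "opp a b" "a \<sim> x" "a \<noteq> x" "e \<sim> a" "e \<sim> x" shows "e \<sim> foot a b x"
  using col_ln[OF assms(4,5,2,3) foot_mem[OF assms(1-3)]] .

text \<open>\<open>x\<close> and \<open>foot a c x\<close> represent the same line through
  \<open>a\<close>, and \<open>x\<close> is its point collinear to \<open>b\<close>.\<close>

lemma foot_inverse:
  assumes "opp a b" "opp a c" "x \<in> quad a b"
  shows "foot a b (foot a c x) = x"
proof -
  have x: "a \<sim> x" "a \<noteq> x" using assms(3) quad_neq[OF assms(1,3)] by (auto simp: quad_def)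
  have q: "foot a c x \<in> quad a c" by (rule foot_quad[OF assms(2) x])
  then have p: "a \<sim> foot a c x" "a \<noteq> foot a c x" using quad_neq[OF assms(2) q] by (auto simp: quad_def)
  show ?thesis
    by (rule foot_eqI[OF assms(1) p ln_swap[OF x foot_mem[OF assms(2) x]]])
      (use p assms(3) in \<open>auto simp: quad_def\<close>)
qed

lemma foot_col:
  assumes "opp a b" "a \<sim> x" "a \<noteq> x" "a \<sim> y" "a \<noteq> y" "x \<sim> y"
  shows "foot a b x \<sim> foot a b y"
proof -
  have "y \<sim> foot a b x" using foot_perp_of[OF assms(1-3) _ col_sym[OF assms(6)]] assms(4) col_sym by blast
  moreover have "foot a b x \<sim> a" using foot_quad[OF assms(1-3)] col_sym by (auto simp: quad_def)
  ultimately show ?thesis using foot_perp_of[OF assms(1,4,5)] col_sym by blast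
qed

section \<open>Action of a perspectivity on the lines through a common neighbour\<close>

lemma foot_cong_target:
  assumes o: "opp a b" "opp a b'" and x: "a \<sim> x" "a \<noteq> x"
    and q: "q \<sim> a" "q \<sim> b" "q \<sim> b'" "q \<sim> x" "q \<noteq> b" "q \<noteq> b'" "ln q b = ln q b'"
  shows "foot a b x = foot a b' x"
proof (rule foot_eqI[OF o(1) x foot_mem[OF o(2) x]])
  have "b' \<sim> foot a b' x" by (rule foot_perp[OF o(2) x])
  \<comment> \<open>Being collinear to \<open>q\<close> and \<open>b'\<close>, the foot is collinear
    to the whole line \<open>q b'\<close>, which contains \<open>b\<close>.\<close>
  moreover have "q \<sim> foot a b' x" by (rule foot_perp_of[OF o(2) x q(1,4)])
  moreover have "b \<in> ln q b'" using ln_right[OF q(2,5)] q(7) by simp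
  ultimately show "b \<sim> foot a b' x" using col_ln[OF _ _ q(3,6)] col_sym by blast
qed

text \<open>In the plane spanned by \<open>a\<close>, \<open>q\<close> and \<open>x\<close>, the
  points collinear to \<open>b\<close> form the line joining \<open>q\<close> to
  \<open>foot a b x\<close>. By Pasch this line meets \<open>a x'\<close>, and the common point is
  the foot of \<open>x'\<close>. So the foot may move, but only along a line through
  \<open>q\<close>. The last assumption makes the three points span a plane.\<close>

lemma foot_cong_arg:
  assumes o: "opp a b" and x: "a \<sim> x" "a \<sim> x'"
    and q: "q \<sim> a" "q \<sim> b" "q \<sim> x" "q \<sim> x'" "q \<noteq> a" "q \<noteq> x" "q \<noteq> x'" "ln q x = ln q x'"
    and nx: "x \<notin> ln q a"
  shows "ln q (foot a b x) = ln q (foot a b x')" "q \<noteq> foot a b x" "q \<sim> foot a b x"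
proof -
  have n1: "a \<noteq> x" using nx ln_right q(1,5) by blast
  have x'q: "x' \<in> ln q x" using ln_right[OF q(4,7)] q(8) by simp
  have n2: "a \<noteq> x'"
    using ln_right[OF q(3,6)] q(8) nx by auto
  define z where "z = foot a b x"
  have z: "z \<in> ln a x" "b \<sim> z" using foot_spec[OF o x(1) n1] by (simp_all add: z_def)
  have az: "a \<sim> z" "a \<noteq> z" using foot_quad[OF o x(1) n1] quad_neq[OF o foot_quad[OF o x(1) n1]] by (auto simp: z_def quad_def)
  have qz: "q \<sim> z" unfolding z_def by (rule foot_perp_of[OF o x(1) n1 q(1,3)])
  have xz: "x \<in> ln a z" by (rule ln_swap[OF x(1) n1 z(1)]) (use az in simp)
  show nz: "q \<noteq> foot a b x"
  proof
    assume "q = foot a b x"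
    then have "x \<in> ln q a" using xz ln_sym unfolding z_def by metis
    then show False using nx by simp
  qed
  show "q \<sim> foot a b x" using qz by (simp add: z_def)
  have zx': "z \<sim> x'" using col_ln[OF _ _ q(3,6) x'q, of z] qz ln_col[OF x(1) n1 z(1) ln_right[OF x(1) n1]] col_sym by blast
  have "{a, z, x', q} \<subseteq> points G" using az q col_pts by blast
  then have "clique {a, z, x', q}"
    unfolding clique_def using az x q qz zx' col_sym col_refl by simp
  moreover have "x \<in> ln x' q"
    using ln_right[OF q(3,6)] q(8) ln_sym by metis
  ultimately obtain w where w: "w \<in> ln a x'" "w \<in> ln z q"
    using pasch[of a z x' q x] az(2) q(7) n2 nz xz unfolding z_def by metis
  have "b \<sim> w" using col_ln[OF z(2) _ col_sym[OF qz] _ w(2)] q(2) nz col_sym unfolding z_def by metis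
  then have pw: "foot a b x' = w" by (rule foot_eqI[OF o x(2) n2 w(1)])
  have "w \<noteq> q"
  proof
    assume "w = q"
    then have "x' \<in> ln q a" using ln_swap[OF x(2) n2 w(1)] q(5) ln_sym by metis
    then have "a \<in> ln q x'" using ln_swap[OF q(1,5)] q(7) by metis
    then show False using nx ln_swap[OF q(3,6)] q(5,8) by metis
  qed
  then have "ln q w = ln q z" using ln_cong[OF qz _ _ \<open>w \<noteq> q\<close>] nz w(2) ln_sym unfolding z_def by metis
  then show "ln q (foot a b x) = ln q (foot a b x')" using pw by (simp add: z_def)
qed

text \<open>The same plane is used, but the centre now moves along \<open>q a\<close>: the line
  joining \<open>q\<close> to the first foot consists of points collinear to \<open>b\<close>, and
  Pasch makes it meet \<open>a' x\<close>.\<close>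

lemma foot_cong_centre:
  assumes o: "opp a b" "opp a' b" and x: "a \<sim> x" "a' \<sim> x"
    and q: "q \<sim> a" "q \<sim> a'" "q \<sim> b" "q \<sim> x" "q \<noteq> a" "q \<noteq> a'" "q \<noteq> x" "ln q a = ln q a'"
    and nx: "x \<notin> ln q a"
  shows "ln q (foot a b x) = ln q (foot a' b x)"
proof -
  have n1: "a \<noteq> x" using nx ln_right q(1,5) by blast
  have n2: "a' \<noteq> x" using nx ln_right q(2,6,8) by metis
  have a'q: "a' \<in> ln q a" using ln_right[OF q(2,6)] q(8) by simp
  define z where "z = foot a b x"
  have z: "z \<in> ln a x" "b \<sim> z" using foot_spec[OF o(1) x(1) n1] by (simp_all add: z_def)
  have az: "a \<sim> z" "a \<noteq> z" using foot_quad[OF o(1) x(1) n1] quad_neq[OF o(1) foot_quad[OF o(1) x(1) n1]] by (auto simp: z_def quad_def)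
  have qz: "q \<sim> z" unfolding z_def by (rule foot_perp_of[OF o(1) x(1) n1 q(1,4)])
  have xz: "x \<in> ln a z" by (rule ln_swap[OF x(1) n1 z(1)]) (use az in simp)
  have nz: "q \<noteq> z" using xz nx ln_sym by metis
  show ?thesis
  \<comment> \<open>If \<open>x\<close> is collinear to \<open>b\<close>, it is its own foot from
    either centre; otherwise \<open>x\<close> and \<open>z\<close> span the line \<open>a x\<close>,
    as Pasch requires.\<close>
  proof (cases "z = x")
    case True
    then have "foot a' b x = x" using z x by (intro foot_fix o) (simp add: quad_def)
    then show ?thesis using True by (simp add: z_def)
  next
    case False
    have a'z: "a' \<sim> z" using col_ln[OF _ _ q(1,5) a'q, of z] qz az col_sym by blast
    have "{x, z, a', q} \<subseteq> points G" using az q col_pts by blast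
    then have "clique {x, z, a', q}"
      unfolding clique_def using az x q qz a'z ln_col[OF x(1) n1 z(1) ln_right[OF x(1) n1]] col_sym col_refl by simp
    moreover have "a \<in> ln a' q"
      using ln_right[OF q(1,5)] q(8) ln_sym by metis
    moreover have "a \<in> ln x z" using ln_swap[of x a z] z(1) False x(1) n1 col_sym ln_sym by metis
    ultimately obtain w where w: "w \<in> ln x a'" "w \<in> ln z q"
      using pasch[of x z a' q a] False q(6) n2 nz by metis
    have "b \<sim> w" using col_ln[OF z(2) _ col_sym[OF qz] _ w(2)] q(3) nz col_sym by metis
    then have pw: "foot a' b x = w" using foot_eqI[OF o(2) x(2) n2] w(1) ln_sym by metis
    have "w \<noteq> q"
    proof
      assume "w = q"
      then have "q \<in> ln a' x" using w(1) ln_sym by metis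
      then have "x \<in> ln a' q" using ln_swap[OF x(2) n2] q(6) by metis
      then show False using nx q(8) ln_sym by metis
    qed
    then have "ln q w = ln q z" using ln_cong[OF qz nz _ \<open>w \<noteq> q\<close>] w(2) ln_sym by metis
    then show "ln q (foot a b x) = ln q (foot a' b x)" using pw by (simp add: z_def)
  qed
qed

lemma ln_perp_iff:
  assumes "q \<sim> b" "q \<sim> b'" "q \<noteq> b" "q \<noteq> b'" "ln q b = ln q b'" "e \<sim> q" "e \<sim> b"
  shows "e \<sim> b'"
  using col_ln[OF assms(6,7,1,3)] ln_right[OF assms(2,4)] assms(5) by simp

text \<open>Target, argument and centre are moved one at a time; each intermediate pair of centres
  remains non-collinear, so its feet are defined.\<close>

lemma foot_cong:
  assumes o: "opp a b" and x: "a \<sim> x" "a' \<sim> x'"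
    and qa: "q \<sim> a" "q \<sim> a'" "q \<noteq> a" "q \<noteq> a'" "ln q a = ln q a'"
    and qb: "q \<sim> b" "q \<sim> b'" "q \<noteq> b" "q \<noteq> b'" "ln q b = ln q b'"
    and qx: "q \<sim> x" "q \<sim> x'" "q \<noteq> x" "q \<noteq> x'" "ln q x = ln q x'"
    and nx: "x \<notin> ln q a"
  shows "ln q (foot a b x) = ln q (foot a' b' x')"
proof -
  have "\<not> a \<sim> b'"
    using ln_perp_iff[OF qb(2,1,4,3) qb(5)[symmetric], of a] o qa(1) col_sym unfolding opp_def by blast
  then have o1: "opp a b'" using o qb(2) col_pts unfolding opp_def by blast
  have "\<not> b' \<sim> a'"
    using ln_perp_iff[OF qa(2,1,4,3) qa(5)[symmetric], of b'] o1 qb(2) col_sym unfolding opp_def by blast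
  then have o2: "opp a' b'" using o1 qa(2) col_pts col_sym unfolding opp_def by blast
  have ax': "a \<sim> x'" using ln_perp_iff[OF qx(1-5) col_sym[OF qa(1)] x(1)] .
  have nx': "x' \<notin> ln q a"
  proof
    assume "x' \<in> ln q a"
    then have "ln q x' = ln q a" using ln_cong[OF qa(1,3)] qx(4) by metis
    then show False using nx qx(5) ln_right[OF qx(1,3)] by simp
  qed
  have n1: "a \<noteq> x" using nx ln_right qa(1,3) by blast
  have "foot a b x = foot a b' x" by (rule foot_cong_target[OF o o1 x(1) n1 qa(1) qb(1,2) qx(1) qb(3-5)])
  also have "ln q \<dots> = ln q (foot a b' x')"
    by (rule foot_cong_arg(1)[OF o1 x(1) ax' qa(1) qb(2) qx(1,2) qa(3) qx(3-5) nx])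
  also have "\<dots> = ln q (foot a' b' x')"
    by (rule foot_cong_centre[OF o1 o2 ax' x(2) qa(1,2) qb(2) qx(2) qa(3,4) qx(4) qa(5) nx'])
  finally show ?thesis .
qed

text \<open>Provides the side conditions of \<open>foot_cong\<close> along a path, where
  \<open>e\<close> is the other centre to which \<open>x\<close> is collinear. Were \<open>x\<close>
  on \<open>q a\<close>, then \<open>e\<close>, being collinear to \<open>q\<close> and
  \<open>x\<close>, would be collinear to \<open>a\<close>.\<close>

lemma foot_residue:
  assumes "opp a e" "opp a b" "x \<in> quad a e" "q \<in> quad a b" "q \<sim> x" "q \<sim> e" "q \<noteq> x"
  shows "x \<notin> ln q a" "q \<sim> foot a b x" "q \<noteq> foot a b x"
proof -
  have q: "q \<sim> a" "q \<noteq> a" using assms(2,4) quad_neq col_sym by (auto simp: quad_def)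
  have x: "a \<sim> x" "a \<noteq> x" using assms(1,3) quad_neq by (auto simp: quad_def)
  show nx: "x \<notin> ln q a"
  proof
    assume "x \<in> ln q a"
    then have "e \<sim> a" using col_ln'[OF _ _ q, of e x] assms(3,6,7) col_sym unfolding quad_def by blast
    then show False using assms(1) col_sym unfolding opp_def by blast
  qed
  have "b \<sim> q" using assms(4) by (simp add: quad_def)
  then show "q \<sim> foot a b x" "q \<noteq> foot a b x"
    using foot_cong_arg(2,3)[OF assms(2) x(1,1) q(1) _ assms(5,5) q(2) assms(7,7) refl nx] col_sym by blast+
qed

text \<open>The four inner feet follow the path. The outer \<open>foot a b\<close> stays on the line
  reached through \<open>a\<close> and only passes to its representative in \<open>quad a b\<close>,
  so that this set is mapped to itself.\<close>

definition round_trip :: "'a \<Rightarrow> 'a \<Rightarrow> 'a \<Rightarrow> 'a \<Rightarrow> 'a \<Rightarrow> 'a" where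
  "round_trip a b c c' x = foot a b (foot c' a (foot b c' (foot c b (foot a c x))))"

lemma foot_step:
  assumes "opp a b" "opp a c" "x \<in> quad a b"
  shows "foot a c x \<in> quad a c" "foot a c x \<in> quad c a"
  using foot_quad[OF assms(2)] assms(3) quad_neq[OF assms(1,3)] quad_sym by (auto simp: quad_def)

lemma round_trip_quad:
  assumes "opp a b" "opp a c" "opp b c" "opp a c'" "opp b c'" "x \<in> quad a b"
  shows "round_trip a b c c' x \<in> quad a b"
proof -
  note os = assms(1-5) assms(1-5)[THEN opp_sym]
  show ?thesis unfolding round_trip_def
    by (intro foot_step(1)[of a c'] foot_step(2)[of c' b] foot_step(2)[of b c]
      foot_step(2)[of c a] foot_step(2)[of a b]) (use os assms(6) in \<open>auto simp: quad_sym\<close>)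
qed

lemma round_trip_inverse:
  assumes "opp a b" "opp a c" "opp b c" "opp a c'" "opp b c'" "x \<in> quad a b"
  shows "round_trip a b c' c (round_trip a b c c' x) = x"
proof -
  note os = assms(1-5) assms(1-5)[THEN opp_sym]
  define x1 where "x1 = foot a c x"
  define x2 where "x2 = foot c b x1"
  define x3 where "x3 = foot b c' x2"
  define x4 where "x4 = foot c' a x3"
  define x5 where "x5 = foot a b x4"
  have q1: "x1 \<in> quad a c" "x1 \<in> quad c a" using foot_step[OF os(1,2) assms(6)] by (simp_all add: x1_def)
  have q2: "x2 \<in> quad c b" "x2 \<in> quad b c" using foot_step[OF os(7,8) q1(2)] by (simp_all add: x2_def)
  have q3: "x3 \<in> quad b c'" "x3 \<in> quad c' b" using foot_step[OF os(3,5) q2(2)] by (simp_all add: x3_def)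
  have q4: "x4 \<in> quad c' a" "x4 \<in> quad a c'" using foot_step[OF os(10,9) q3(2)] by (simp_all add: x4_def)
  have "foot a c' x5 = x4" using foot_inverse[OF os(4,1) q4(2)] by (simp add: x5_def)
  moreover have "foot c' b x4 = x3" using foot_inverse[OF os(10,9) q3(2)] by (simp add: x4_def)
  moreover have "foot b c x3 = x2" using foot_inverse[OF os(3,5) q2(2)] by (simp add: x3_def)
  moreover have "foot c a x2 = x1" using foot_inverse[OF os(7,8) q1(2)] by (simp add: x2_def)
  moreover have "foot a b x1 = x" using foot_inverse[OF os(1,2) assms(6)] by (simp add: x1_def)
  ultimately have "round_trip a b c' c x5 = x" by (simp add: round_trip_def)
  then show ?thesis by (simp add: round_trip_def x1_def x2_def x3_def x4_def x5_def)
qed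

lemma foot_col_quad:
  "opp a b \<Longrightarrow> opp a c \<Longrightarrow> x \<in> quad a b \<Longrightarrow> y \<in> quad a b \<Longrightarrow> x \<sim> y \<Longrightarrow> foot a c x \<sim> foot a c y"
  using foot_col quad_neq unfolding quad_def by blast

lemma round_trip_col:
  assumes "opp a b" "opp a c" "opp b c" "opp a c'" "opp b c'" "x \<in> quad a b" "y \<in> quad a b" "x \<sim> y"
  shows "round_trip a b c c' x \<sim> round_trip a b c c' y"
proof -
  note os = assms(1-5) assms(1-5)[THEN opp_sym]
  show ?thesis unfolding round_trip_def
    by (intro foot_col_quad[of a c'] foot_col_quad[of c' b] foot_col_quad[of b c] foot_col_quad[of c a] foot_col_quad[of a b]
      foot_step(2)[of c' b] foot_step(2)[of b c] foot_step(2)[of c a] foot_step(2)[of a b])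
      (use os assms(6-8) in \<open>auto simp: quad_sym\<close>)
qed

lemma round_trip_fix:
  assumes "opp a b" "opp a c" "opp b c" "opp a c'" "opp b c'" "x \<in> quad a b" "c \<sim> x" "c' \<sim> x"
  shows "round_trip a b c c' x = x"
proof -
  note os = assms(1-5) assms(1-5)[THEN opp_sym]
  have "x \<in> quad u v" if "u \<in> {a, b, c, c'}" "v \<in> {a, b, c, c'}" for u v
    using that assms(6-8) by (auto simp: quad_def)
  then show ?thesis using os by (simp add: round_trip_def foot_fix)
qed

text \<open>With equal intermediate centres nothing happens at \<open>b\<close>, and the second half
  of the path undoes the first.\<close>

lemma round_trip_same:
  assumes "opp a b" "opp a c" "opp b c" "x \<in> quad a b"
  shows "round_trip a b c c x = x"
proof -
  note os = assms(1-3) assms(1-3)[THEN opp_sym]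
  define x1 where "x1 = foot a c x"
  define x2 where "x2 = foot c b x1"
  have q1: "x1 \<in> quad a c" "x1 \<in> quad c a" using foot_step[OF os(1,2) assms(4)] by (simp_all add: x1_def)
  have q2: "x2 \<in> quad c b" "x2 \<in> quad b c" using foot_step[OF os(5,6) q1(2)] by (simp_all add: x2_def)
  have "foot b c x2 = x2" by (rule foot_fix[OF os(3) q2(2)])
  moreover have "foot c a x2 = x1" using foot_inverse[OF os(5,6) q1(2)] by (simp add: x2_def)
  moreover have "foot a b x1 = x" using foot_inverse[OF os(1,2) assms(4)] by (simp add: x1_def)
  ultimately show ?thesis by (simp add: round_trip_def x1_def x2_def)
qed

text \<open>\<open>foot_cong\<close> is applied to each of the five feet. Admitting different
  arguments \<open>x\<close> and \<open>y\<close> on one line through \<open>q\<close>, and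
  recording that the result is again a neighbour of \<open>q\<close> other than \<open>q\<close>,
  allows the statement to be applied to a composition of round trips.\<close>

lemma round_trip_cong:
  assumes o: "opp a b" "opp a c" "opp b c" "opp a c'" "opp b c'" and x: "x \<in> quad a b" "y \<in> quad a b"
    and q: "q \<in> quad a b" "q \<sim> c" "q \<sim> c'" "q \<sim> d" "q \<sim> d'" "q \<noteq> d" "q \<noteq> d'"
      "ln q c = ln q d" "ln q c' = ln q d'"
      "q \<sim> x" "q \<sim> y" "q \<noteq> x" "q \<noteq> y" "ln q x = ln q y"
    and o': "opp a d" "opp b d" "opp a d'" "opp b d'"
  shows "ln q (round_trip a b c c' x) = ln q (round_trip a b d d' y)" "q \<noteq> round_trip a b c c' x" "q \<sim> round_trip a b c c' x"
proof -
  note os = o o[THEN opp_sym]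
  note os' = o' o'[THEN opp_sym]
  have qn: "q \<sim> a" "q \<sim> b" "q \<noteq> a" "q \<noteq> b" "q \<noteq> c" "q \<noteq> c'"
    using q(1-3) o quad_neq[OF o(1) q(1)] col_sym unfolding quad_def opp_def by auto
  have qq: "q \<in> quad u v" if "u \<in> {a, b, c, c', d, d'}" "v \<in> {a, b, c, c', d, d'}" for u v
    using that q(1-5) col_sym by (auto simp: quad_def)
  define x1 where "x1 = foot a c x"
  define x2 where "x2 = foot c b x1"
  define x3 where "x3 = foot b c' x2"
  define x4 where "x4 = foot c' a x3"
  define y1 where "y1 = foot a d y"
  define y2 where "y2 = foot d b y1"
  define y3 where "y3 = foot b d' y2"
  define y4 where "y4 = foot d' a y3"
  have q1: "x1 \<in> quad a c" "x1 \<in> quad c a" using foot_step[OF os(1,2) x(1)] by (simp_all add: x1_def)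
  have q2: "x2 \<in> quad c b" "x2 \<in> quad b c" using foot_step[OF os(7,8) q1(2)] by (simp_all add: x2_def)
  have q3: "x3 \<in> quad b c'" "x3 \<in> quad c' b" using foot_step[OF os(3,5) q2(2)] by (simp_all add: x3_def)
  have q4: "x4 \<in> quad c' a" "x4 \<in> quad a c'" using foot_step[OF os(10,9) q3(2)] by (simp_all add: x4_def)
  have r1: "y1 \<in> quad a d" "y1 \<in> quad d a" using foot_step[OF os(1) os'(1) x(2)] by (simp_all add: y1_def)
  have r2: "y2 \<in> quad d b" "y2 \<in> quad b d" using foot_step[OF os'(5,6) r1(2)] by (simp_all add: y2_def)
  have r3: "y3 \<in> quad b d'" "y3 \<in> quad d' b" using foot_step[OF os'(2,4) r2(2)] by (simp_all add: y3_def)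
  have r4: "y4 \<in> quad d' a" "y4 \<in> quad a d'" using foot_step[OF os'(8,7) r3(2)] by (simp_all add: y4_def)
  have cols: "a \<sim> x" "a \<sim> y" "c \<sim> x1" "d \<sim> y1" "b \<sim> x2" "b \<sim> y2" "c' \<sim> x3" "d' \<sim> y3" "a \<sim> x4" "a \<sim> y4"
    using x q1 q2 q3 q4 r1 r2 r3 r4 by (auto simp: quad_def)
  \<comment> \<open>The point \<open>e\<close> of \<open>foot_residue\<close> is \<open>b\<close>,
    \<open>a\<close>, \<open>c\<close>, \<open>b\<close>, \<open>c'\<close> in turn: besides the
    current centre, the current point is collinear to this one.\<close>
  note s1 = foot_residue[OF os(1,2) x(1) qq[of a c] q(10) qn(2) q(12), folded x1_def, simplified]
  note t1 = foot_residue[OF os(1) os'(1) x(2) qq[of a d] q(11) qn(2) q(13), folded y1_def, simplified]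
  note s2 = foot_residue[OF os(7,8) q1(2) qq[of c b] s1(2) qn(1) s1(3), folded x2_def, simplified]
  note t2 = foot_residue[OF os'(5,6) r1(2) qq[of d b] t1(2) qn(1) t1(3), folded y2_def, simplified]
  note s3 = foot_residue[OF os(3,5) q2(2) qq[of b c'] s2(2) q(2) s2(3), folded x3_def, simplified]
  note t3 = foot_residue[OF os'(2,4) r2(2) qq[of b d'] t2(2) q(4) t2(3), folded y3_def, simplified]
  note s4 = foot_residue[OF os(10,9) q3(2) qq[of c' a] s3(2) qn(2) s3(3), folded x4_def, simplified]
  note t4 = foot_residue[OF os'(8,7) r3(2) qq[of d' a] t3(2) qn(2) t3(3), folded y4_def, simplified]
  note s5 = foot_residue[OF os(4,1) q4(2) qq[of a b] s4(2) q(3) s4(3), simplified]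
  have e1: "ln q x1 = ln q y1" unfolding x1_def y1_def
    by (rule foot_cong[OF o(2) cols(1,2) qn(1,1,3,3) refl q(2,4) qn(5) q(6,8,10-14) s1(1)])
  have e2: "ln q x2 = ln q y2" unfolding x2_def y2_def
    by (rule foot_cong[OF os(8) cols(3,4) q(2,4) qn(5) q(6,8) qn(2,2,4,4) refl s1(2) t1(2) s1(3) t1(3) e1 s2(1)])
  have e3: "ln q x3 = ln q y3" unfolding x3_def y3_def
    by (rule foot_cong[OF o(5) cols(5,6) qn(2,2,4,4) refl q(3,5) qn(6) q(7,9) s2(2) t2(2) s2(3) t2(3) e2 s3(1)])
  have e4: "ln q x4 = ln q y4" unfolding x4_def y4_def
    by (rule foot_cong[OF os(9) cols(7,8) q(3,5) qn(6) q(7,9) qn(1,1,3,3) refl s3(2) t3(2) s3(3) t3(3) e3 s4(1)])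
  have "ln q (foot a b x4) = ln q (foot a b y4)"
    by (rule foot_cong[OF o(1) cols(9,10) qn(1,1,3,3) refl qn(2,2,4,4) refl s4(2) t4(2) s4(3) t4(3) e4 s5(1)])
  then show "ln q (round_trip a b c c' x) = ln q (round_trip a b d d' y)"
    by (simp add: round_trip_def x1_def x2_def x3_def x4_def y1_def y2_def y3_def y4_def)
  show "q \<noteq> round_trip a b c c' x" "q \<sim> round_trip a b c c' x"
    using s5(2,3) by (simp_all add: round_trip_def x1_def x2_def x3_def x4_def)
qed

end

section \<open>Root elations of the first kind\<close>

text \<open>The typical element of \<open>apartments\<close> as a function of its vertices, so that
  the symmetries of the quadrangle become equations.\<close>

definition quad_figure :: "'a geometry \<Rightarrow> 'a \<Rightarrow> 'a \<Rightarrow> 'a \<Rightarrow> 'a \<Rightarrow> 'a figure" where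
  "quad_figure G d q u n = ({d, q, u, n},
    {line_through G d q, line_through G q u, line_through G u n, line_through G n d})"

lemma collinear_sym: "collinear G x y \<Longrightarrow> collinear G y x"
  by (auto simp: collinear_def)

lemma line_through_sym: "line_through G x y = line_through G y x"
  unfolding line_through_def by (simp add: conj_commute)

lemma ordinary_quadrangle_rotate: "ordinary_quadrangle G d q u n \<Longrightarrow> ordinary_quadrangle G q u n d"
  using collinear_sym[of G n q] by (auto simp: ordinary_quadrangle_def dest: collinear_sym)

lemma ordinary_quadrangle_reflect: "ordinary_quadrangle G d q u n \<Longrightarrow> ordinary_quadrangle G d n u q"
  by (auto simp: ordinary_quadrangle_def dest: collinear_sym)

lemma quad_figure_rotate: "quad_figure G d q u n = quad_figure G q u n d"
  by (auto simp: quad_figure_def)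

lemma quad_figure_reflect: "quad_figure G d q u n = quad_figure G d n u q"
  unfolding quad_figure_def
  using line_through_sym[of G d q] line_through_sym[of G q u] line_through_sym[of G u n]
    line_through_sym[of G n d] by auto

text \<open>A rotation brings \<open>d\<close> to the first place. Then \<open>q\<close>, not being
  the opposite vertex, is one of the two neighbours, and a reflection settles which.\<close>

lemma apartment_obtain:
  assumes "A \<in> apartments G" "d \<in> fst A" "q \<in> fst A" "collinear G d q" "d \<noteq> q"
  obtains u n where "ordinary_quadrangle G d q u n" "A = quad_figure G d q u n"
proof -
  obtain d0 q0 u0 n0 where 0: "ordinary_quadrangle G d0 q0 u0 n0" "A = quad_figure G d0 q0 u0 n0"
    using assms(1) unfolding apartments_def quad_figure_def by blast
  have "d \<in> {d0, q0, u0, n0}" using assms(2) 0(2) by (simp add: quad_figure_def)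
  then obtain q1 u1 n1 where 1: "ordinary_quadrangle G d q1 u1 n1" "A = quad_figure G d q1 u1 n1"
    using 0 ordinary_quadrangle_rotate quad_figure_rotate by (metis empty_iff insert_iff)
  have "q \<in> {q1, u1, n1}" using assms(3,5) 1(2) by (auto simp: quad_figure_def)
  moreover have "q \<noteq> u1" using 1(1) assms(4) by (auto simp: ordinary_quadrangle_def)
  ultimately consider "q = q1" | "q = n1" by blast
  then show ?thesis using 1 that ordinary_quadrangle_reflect quad_figure_reflect by metis
qed

section \<open>The geometry induced on the common perp of two non-collinear points\<close>

locale opposite_points = ranked_polar_space +
  fixes a b :: 'a
  assumes ab: "opp a b"
begin

abbreviation Q where "Q \<equiv> quad a b"
abbreviation \<Gamma> where "\<Gamma> \<equiv> induced G Q"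

lemma Q_pts: "x \<in> Q \<Longrightarrow> x \<in> points G"
  using col_pts by (auto simp: quad_def)

lemma Q_cols: "x \<in> Q \<Longrightarrow> a \<sim> x \<and> b \<sim> x \<and> x \<sim> a \<and> x \<sim> b"
  using col_sym by (auto simp: quad_def)

lemma ln_sub_Q: "x \<in> Q \<Longrightarrow> y \<in> Q \<Longrightarrow> x \<sim> y \<Longrightarrow> x \<noteq> y \<Longrightarrow> ln x y \<subseteq> Q"
  using col_ln[of _ x y] by (auto simp: quad_def)

lemma points_\<Gamma>: "points \<Gamma> = Q"
  by (simp add: induced_def)

lemma lines_\<Gamma>: "l \<in> lines \<Gamma> \<longleftrightarrow> l \<in> lines G \<and> l \<subseteq> Q"
  by (simp add: induced_def)

lemma ln_in_\<Gamma>: "x \<in> Q \<Longrightarrow> y \<in> Q \<Longrightarrow> x \<sim> y \<Longrightarrow> x \<noteq> y \<Longrightarrow> ln x y \<in> lines \<Gamma>"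
  using ln_sub_Q ln_line lines_\<Gamma> by simp

lemma collinear_\<Gamma>: "collinear \<Gamma> x y \<longleftrightarrow> x \<in> Q \<and> y \<in> Q \<and> x \<sim> y"
proof
  assume "collinear \<Gamma> x y"
  then have "x \<in> Q" "y \<in> Q" "x = y \<or> (\<exists>l\<in>lines G. x \<in> l \<and> y \<in> l)"
    by (auto simp: collinear_def induced_def)
  then show "x \<in> Q \<and> y \<in> Q \<and> x \<sim> y" using Q_pts by (simp add: collinear_def)
next
  assume xy: "x \<in> Q \<and> y \<in> Q \<and> x \<sim> y"
  show "collinear \<Gamma> x y"
  proof (cases "x = y")
    case False
    then have "ln x y \<in> lines \<Gamma>" "x \<in> ln x y" "y \<in> ln x y" using xy ln_in_\<Gamma> ln by auto
    then show ?thesis using xy unfolding collinear_def points_\<Gamma> by blast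
  qed (use xy in \<open>simp add: collinear_def points_\<Gamma>\<close>)
qed

lemma line_through_\<Gamma>:
  assumes "x \<in> Q" "y \<in> Q" "x \<sim> y" "x \<noteq> y" shows "line_through \<Gamma> x y = ln x y"
  unfolding line_through_def[of \<Gamma>]
proof (rule the_equality)
  show "ln x y \<in> lines \<Gamma> \<and> x \<in> ln x y \<and> y \<in> ln x y"
    using ln_in_\<Gamma>[OF assms] ln[OF assms(3,4)] by simp
  show "l = ln x y" if "l \<in> lines \<Gamma> \<and> x \<in> l \<and> y \<in> l" for l
    using ln_eqI[of l x y] that assms(4) lines_\<Gamma> by simp
qed

lemma line_two_points:
  assumes "l \<in> lines \<Gamma>" "x \<in> l"
  obtains y where "y \<in> l" "y \<noteq> x" "x \<sim> y" "l = ln x y"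
proof -
  obtain y where y: "y \<in> l" "y \<noteq> x" using third_point[of l x x] assms(1) lines_\<Gamma> by blast
  then show ?thesis
    using that[of y] line_col[of l x y] ln_eqI[of l x y] assms lines_\<Gamma> by auto
qed

lemma line_nonempty:
  assumes "l \<in> lines \<Gamma>" obtains x where "x \<in> l"
  using third_point[of l] assms lines_\<Gamma> by blast

end

text \<open>This is the consequence of rank three on which the elations of the first kind rest; it
  makes a line of \<Gamma> recognisable from collinearity alone. It is established in
  \<open>rank_three_no_triangle\<close>.\<close>

locale residual_quadrangle = opposite_points +
  assumes no_triangle: "\<lbrakk>x \<in> quad a b; y \<in> quad a b; z \<in> quad a b; x \<sim> y; x \<noteq> y; z \<sim> x; z \<sim> y\<rbrakk> \<Longrightarrow> z \<in> ln x y"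
begin

text \<open>A round trip is meaningful on \<open>Q\<close> only, whereas a collineation has to be
  the identity elsewhere.\<close>

definition extend :: "('a \<Rightarrow> 'a) \<Rightarrow> 'a \<Rightarrow> 'a" where
  "extend g x = (if x \<in> Q then g x else x)"

text \<open>Without triangles, the line through two collinear points is the set of points of
  \<Gamma> collinear to both, so it is respected by a bijection that preserves collinearity in both
  directions.\<close>

lemma image_line:
  assumes "\<And>x. x \<in> Q \<Longrightarrow> g x \<in> Q" "\<And>x. x \<in> Q \<Longrightarrow> h x \<in> Q"
    and gh: "\<And>x. x \<in> Q \<Longrightarrow> g (h x) = x" and hg: "\<And>x. x \<in> Q \<Longrightarrow> h (g x) = x"
    and gc: "\<And>x y. x \<in> Q \<Longrightarrow> y \<in> Q \<Longrightarrow> x \<sim> y \<Longrightarrow> g x \<sim> g y"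
    and hc: "\<And>x y. x \<in> Q \<Longrightarrow> y \<in> Q \<Longrightarrow> x \<sim> y \<Longrightarrow> h x \<sim> h y"
    and l: "l \<in> lines \<Gamma>"
  shows "extend g ` l \<in> lines \<Gamma>"
proof -
  obtain x where x: "x \<in> l" using line_nonempty[OF l] .
  obtain y where y: "y \<in> l" "y \<noteq> x" "x \<sim> y" "l = ln x y" using line_two_points[OF l x] .
  have lQ: "l \<subseteq> Q" "l \<in> lines G" using l lines_\<Gamma> by auto
  have xy: "x \<in> Q" "y \<in> Q" using lQ x y by auto
  have g: "g x \<in> Q" "g y \<in> Q" "g x \<sim> g y" using xy assms(1) gc y(3) by auto
  have ne: "g x \<noteq> g y" using hg[OF xy(1)] hg[OF xy(2)] y(2) by auto
  have "extend g ` l = ln (g x) (g y)"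
  proof (intro equalityI subsetI)
    fix w assume "w \<in> extend g ` l"
    then obtain z where z: "z \<in> l" "w = g z" using lQ by (auto simp: extend_def)
    then have "z \<sim> x" "z \<sim> y" "z \<in> Q" using line_col[OF lQ(2) z(1)] x y lQ by auto
    then show "w \<in> ln (g x) (g y)"
      using no_triangle[OF g(1,2) _ g(3) ne] gc xy z(2) assms(1) by simp
  next
    fix w assume w: "w \<in> ln (g x) (g y)"
    then have wQ: "w \<in> Q" using ln_sub_Q[OF g ne] by blast
    have "w \<sim> g x" "w \<sim> g y" using ln_col[OF g(3) ne w] ln_left[OF g(3) ne] ln_right[OF g(3) ne] by auto
    then have "h w \<sim> x" "h w \<sim> y" using hc[OF wQ g(1)] hc[OF wQ g(2)] hg xy by auto
    then have "h w \<in> l" using no_triangle[OF xy assms(2)[OF wQ] y(3) y(2)[symmetric]] y(4) by simp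
    moreover have "w = extend g (h w)" using gh[OF wQ] assms(2)[OF wQ] by (simp add: extend_def)
    ultimately show "w \<in> extend g ` l" by blast
  qed
  then show ?thesis using ln_in_\<Gamma>[OF g ne] by simp
qed

lemma extend_collineation:
  assumes g: "\<And>x. x \<in> Q \<Longrightarrow> g x \<in> Q" and h: "\<And>x. x \<in> Q \<Longrightarrow> h x \<in> Q"
    and gh: "\<And>x. x \<in> Q \<Longrightarrow> g (h x) = x" and hg: "\<And>x. x \<in> Q \<Longrightarrow> h (g x) = x"
    and gc: "\<And>x y. x \<in> Q \<Longrightarrow> y \<in> Q \<Longrightarrow> x \<sim> y \<Longrightarrow> g x \<sim> g y"
    and hc: "\<And>x y. x \<in> Q \<Longrightarrow> y \<in> Q \<Longrightarrow> x \<sim> y \<Longrightarrow> h x \<sim> h y"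
  shows "collineation \<Gamma> (extend g)"
proof -
  have e: "extend g (extend h x) = x" "extend h (extend g x) = x" for x
    using g h gh hg by (auto simp: extend_def)
  have "extend g permutes Q"
    by (rule bij_imp_permutes) (auto simp: extend_def intro!: bij_betw_byWitness[where f' = h] g h gh hg)
  moreover have "bij_betw ((`) (extend g)) (lines \<Gamma>) (lines \<Gamma>)"
  proof (rule bij_betw_byWitness[where f' = "(`) (extend h)"])
    show "(`) (extend g) ` lines \<Gamma> \<subseteq> lines \<Gamma>" using image_line[OF assms] by blast
    show "(`) (extend h) ` lines \<Gamma> \<subseteq> lines \<Gamma>" using image_line[OF h g hg gh hc gc] by blast
  qed (simp_all add: image_image e)
  ultimately show ?thesis by (simp add: collineation_def points_\<Gamma>)
qed

lemma collineation_line_through: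
  assumes "collineation \<Gamma> g" "x \<in> Q" "y \<in> Q" "x \<sim> y" "x \<noteq> y"
  shows "g ` line_through \<Gamma> x y = line_through \<Gamma> (g x) (g y)"
proof -
  have p: "g permutes Q" and bl: "bij_betw ((`) g) (lines \<Gamma>) (lines \<Gamma>)"
    using assms(1) by (auto simp: collineation_def points_\<Gamma>)
  let ?l = "line_through \<Gamma> x y"
  have l: "?l = ln x y" "?l \<in> lines \<Gamma>" using line_through_\<Gamma>[OF assms(2-)] ln_in_\<Gamma>[OF assms(2-)] by auto
  have gl: "g ` ?l \<in> lines \<Gamma>" using bl l(2) bij_betwE by blast
  have m: "g x \<in> g ` ?l" "g y \<in> g ` ?l" using ln[OF assms(4,5)] l(1) by auto
  have ne: "g x \<noteq> g y" using p assms(5) permutes_inj injD by metis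
  have gQ: "g x \<in> Q" "g y \<in> Q" using p assms(2,3) permutes_in_image by metis+
  have "g x \<sim> g y" using line_col gl m lines_\<Gamma> by blast
  then show ?thesis using line_through_\<Gamma>[OF gQ _ ne] ln_eqI[OF _ m ne] gl lines_\<Gamma> by simp
qed

lemma quadrangle_facts:
  assumes "ordinary_quadrangle \<Gamma> d q u n"
  shows "d \<in> Q" "q \<in> Q" "u \<in> Q" "n \<in> Q" "d \<sim> q" "q \<sim> u" "u \<sim> n" "n \<sim> d" "\<not> d \<sim> u" "\<not> q \<sim> n"
    "q \<sim> d" "u \<sim> q" "n \<sim> u" "d \<sim> n" "\<not> u \<sim> d" "\<not> n \<sim> q"
    "d \<noteq> q" "q \<noteq> u" "u \<noteq> n" "n \<noteq> d"
proof -
  show c: "d \<in> Q" "q \<in> Q" "u \<in> Q" "n \<in> Q" "d \<sim> q" "q \<sim> u" "u \<sim> n" "n \<sim> d" "\<not> d \<sim> u" "\<not> q \<sim> n"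
    using assms unfolding ordinary_quadrangle_def collinear_\<Gamma> by auto
  show s: "q \<sim> d" "u \<sim> q" "n \<sim> u" "d \<sim> n" "\<not> u \<sim> d" "\<not> n \<sim> q" using c col_sym by blast+
  show "d \<noteq> q" "q \<noteq> u" "u \<noteq> n" "n \<noteq> d" using c s by blast+
qed

lemma figure_image_quad_figure:
  assumes g: "collineation \<Gamma> g" and o: "ordinary_quadrangle \<Gamma> d q u n"
  shows "figure_image g (quad_figure \<Gamma> d q u n) = quad_figure \<Gamma> (g d) (g q) (g u) (g n)"
  using collineation_line_through[OF g] quadrangle_facts[OF o]
  by (simp add: figure_image_def quad_figure_def)

text \<open>Translates what \<open>round_trip_cong\<close> says about points into the stabilisation
  of lines demanded by the root groups.\<close>

lemma fixes_lines:
  assumes g: "collineation \<Gamma> g" and d: "d \<in> Q" "g d = d"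
    and x: "\<And>x. x \<in> Q \<Longrightarrow> d \<sim> x \<Longrightarrow> d \<noteq> x \<Longrightarrow> ln d (g x) = ln d x"
    and l: "l \<in> lines \<Gamma>" "d \<in> l"
  shows "g ` l = l"
proof -
  obtain y where y: "y \<in> l" "y \<noteq> d" "d \<sim> y" "l = ln d y" using line_two_points[OF l] .
  have yQ: "y \<in> Q" using y(1) l(1) lines_\<Gamma> by auto
  have ne: "d \<noteq> g y" using d(2) g y(2) injD[OF permutes_inj] unfolding collineation_def by metis
  have gQ: "g y \<in> Q" using g yQ permutes_in_image unfolding collineation_def points_\<Gamma> by metis
  have gl: "g ` l = line_through \<Gamma> d (g y)"
    using collineation_line_through[OF g d(1) yQ y(3) y(2)[symmetric]]
      line_through_\<Gamma>[OF d(1) yQ y(3) y(2)[symmetric]] d(2) y(4) by simp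
  have "g ` l \<in> lines \<Gamma>" using g l(1) bij_betwE unfolding collineation_def by blast
  then have "d \<sim> g y" using line_col[of "g ` l" d "g y"] imageI[OF y(1), of g] imageI[OF l(2), of g] d(2) lines_\<Gamma> by simp
  then show ?thesis using gl line_through_\<Gamma>[OF d(1) gQ _ ne] x[OF yQ y(3) y(2)[symmetric]] y(4) by simp
qed

lemma id_collineation: "collineation \<Gamma> id"
  unfolding collineation_def by (simp add: permutes_id)

lemma id_root_groups: "id \<in> root_group1 \<Gamma> d q n" "id \<in> root_group2 \<Gamma> d q"
  using id_collineation by (auto simp: root_group1_def root_group2_def)

text \<open>The path is found backwards: the round trip has to send the lines \<open>au\<close>, \<open>bu'\<close> and \<open>au'\<close> to
  each other in this order. So \<open>c\<close> is taken on a transversal \<open>pr\<close> of \<open>au\<close> and \<open>bu'\<close>, and \<open>c'\<close> collinear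
  to \<open>u'\<close>.\<close>

lemma first_kind_elation:
  assumes o: "ordinary_quadrangle \<Gamma> d q u n" and o': "ordinary_quadrangle \<Gamma> d q u' n"
  shows "\<exists>g\<in>root_group1 \<Gamma> d q n. g u = u'"
proof (cases "u = u'")
  case True
  then show ?thesis using id_root_groups(1) by (metis id_apply)
next
  case uu: False
  note f = quadrangle_facts[OF o] and f' = quadrangle_facts[OF o']
  note nab = ab[unfolded opp_def, THEN conjunct2, THEN conjunct2]
  have nba: "\<not> b \<sim> a" using nab col_sym by blast
  have nu: "\<not> u \<sim> u'"
  proof
    assume u: "u \<sim> u'"
    have "q \<in> ln u u'" "n \<in> ln u u'"
      by (rule no_triangle; use f f' u uu in simp)+
    then show False using ln_col[OF u uu] f by blast
  qed
  note Q = Q_cols[OF f(1)] Q_cols[OF f(2)] Q_cols[OF f(3)] Q_cols[OF f(4)] Q_cols[OF f'(3)]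
  have an: "a \<noteq> u" "b \<noteq> u'" "b \<noteq> u" "a \<noteq> u'" using quad_neq[OF ab] f(3) f'(3) by auto
  have au: "a \<sim> u" "b \<sim> u'" "u \<sim> a" "u' \<sim> b" using Q by auto
  \<comment> \<open>Any third point will do: on the line \<open>a u\<close>, the only point
    collinear to \<open>b\<close> is \<open>u\<close> and the only point collinear to
    \<open>d\<close> is \<open>a\<close>.\<close>
  obtain p where p: "p \<in> ln a u" "p \<noteq> a" "p \<noteq> u" using third_point[OF ln_line[OF au(1) an(1)]] by blast
  have ua: "u \<in> ln a p" "ln a p = ln a u" using ln_swap[OF au(1) an(1) p(1,2)] ln_cong[OF au(1) an(1) p(1,2)] by auto
  have ap: "a \<sim> p" "p \<sim> u" using ln_col[OF au(1) an(1)] p(1) ln[OF au(1) an(1)] by auto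
  have pu: "p \<in> ln u a" using p(1) ln_sym by metis
  have nbp: "\<not> b \<sim> p"
    using col_ln'[OF _ _ au(3) an(1)[symmetric] pu p(3), of b] Q nba by blast
  have op: "opp p b" using nbp ap ab col_pts col_sym unfolding opp_def by blast
  obtain r where r: "r \<in> ln b u'" "p \<sim> r"
    using perp_meets[OF _ ln_line[OF au(2) an(2)], of p] op unfolding opp_def by blast
  have rb: "r \<noteq> b" using r(2) op unfolding opp_def by blast
  have ru: "r \<noteq> u'"
  proof
    assume "r = u'"
    then have "u' \<sim> u" using col_ln[OF _ _ ap(1) p(2)[symmetric] ua(1), of u'] r(2) Q col_sym by blast
    then show False using nu col_sym by blast
  qed
  have br: "b \<sim> r" "r \<sim> u'" using ln_col[OF au(2) an(2)] r(1) ln[OF au(2) an(2)] by auto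
  have rp: "r \<noteq> p" using br nbp by blast
  have ndp: "\<not> d \<sim> p" using col_ln'[OF _ _ ap(1) p(2)[symmetric], of d u] col_ln[of d a p u] Q ua(1) ap p f by metis
  have u'r: "u' \<in> ln b r" using ln_swap[OF au(2) an(2) r(1) rb] .
  have ndr: "\<not> d \<sim> r" using col_ln[OF _ _ br(1) rb[symmetric] u'r, of d] Q f' by blast
  \<comment> \<open>Lying on the transversal \<open>p r\<close>, the point \<open>c\<close> makes
    the first two perspectivities send \<open>a u\<close> to \<open>b u'\<close>; collinearity to
    \<open>d\<close> is needed for the action at \<open>d\<close>.\<close>
  obtain c where c: "c \<in> ln p r" "d \<sim> c"
    using perp_meets[OF _ ln_line[OF r(2) rp[symmetric]], of d] Q_pts f(1) by blast
  have cn: "c \<noteq> p" "c \<noteq> r" using c(2) ndp ndr by auto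
  have rc: "r \<in> ln p c" using ln_swap[OF r(2) rp[symmetric] c(1) cn(1)] .
  have pc: "p \<sim> c" "c \<sim> r" using ln_col[OF r(2) rp[symmetric]] c(1) ln[OF r(2) rp[symmetric]] by auto
  have nac: "\<not> a \<sim> c"
  proof
    assume "a \<sim> c"
    then have "a \<sim> r" using col_ln[OF ap(1) _ pc(1) cn(1)[symmetric] rc] by blast
    then have "a \<sim> b" using col_ln'[of a u' r b] r(1) ru ln_sym an(2) au Q by metis
    then show False using nab by blast
  qed
  have nbc: "\<not> b \<sim> c"
  proof
    assume "b \<sim> c"
    moreover have "p \<in> ln c r" using ln_swap[of r p c] ln_sym col_sym r(2) rp c(1) cn by metis
    ultimately have "b \<sim> p" using col_ln[OF _ br(1) pc(2) cn(2)] by blast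
    then show False using nbp by blast
  qed
  have dc: "d \<noteq> c" using Q nac by blast
  \<comment> \<open>Staying on \<open>d c\<close> keeps the action on the lines through
    \<open>d\<close> trivial, and collinearity to \<open>u'\<close> makes the second half of the
    path end in \<open>u'\<close>.\<close>
  obtain c' where c': "c' \<in> ln d c" "u' \<sim> c'"
    using perp_meets[OF _ ln_line[OF c(2) dc], of u'] Q_pts f'(3) by blast
  have c'd: "c' \<noteq> d" using c'(2) f' by blast
  have cc': "d \<sim> c'" "ln d c' = ln d c" using ln_col[OF c(2) dc ln_left[OF c(2) dc] c'(1)] ln_cong[OF c(2) dc c'(1) c'd] by auto
  have nac': "\<not> a \<sim> c'" using col_ln'[OF _ _ c(2) dc c'(1) c'd, of a] Q nac by blast
  have nbc': "\<not> b \<sim> c'" using col_ln'[OF _ _ c(2) dc c'(1) c'd, of b] Q nbc by blast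
  have os: "opp a b" "opp a c" "opp b c" "opp a c'" "opp b c'"
    using ab nac nbc nac' nbc' c(2) cc'(1) col_pts unfolding opp_def by blast+
  \<comment> \<open>Meant for \<open>q\<close> and \<open>n\<close>, which are collinear to
    \<open>d\<close>, \<open>u\<close> and \<open>u'\<close> and hence to every point constructed
    from these together with \<open>a\<close> and \<open>b\<close>.\<close>
  have perp_c: "e \<sim> c \<and> e \<sim> c'" if "e \<in> Q" "e \<sim> d" "e \<sim> u" "e \<sim> u'" for e
  proof -
    have "e \<sim> p" using col_ln[OF _ that(3) au(1) an(1) p(1)] Q_cols[OF that(1)] by blast
    moreover have "e \<sim> r" using col_ln[OF _ that(4) au(2) an(2) r(1)] Q_cols[OF that(1)] by blast
    ultimately have "e \<sim> c" using col_ln[OF _ _ r(2) rp[symmetric] c(1)] by blast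
    then show ?thesis using col_ln[OF that(2) _ c(2) dc c'(1)] by blast
  qed
  have qc: "q \<sim> c" "q \<sim> c'" "n \<sim> c" "n \<sim> c'" using perp_c[OF f(2)] perp_c[OF f(4)] f f' by auto
  define t where "t = round_trip a b c c'"
  have tfix: "t x = x" if "x \<in> Q" "c \<sim> x" "c' \<sim> x" for x
    unfolding t_def by (rule round_trip_fix[OF os that])
  have "t u = u'"
  proof -
    \<comment> \<open>The successive points of the path are \<open>u\<close>, \<open>p\<close>,
      \<open>r\<close>, \<open>u'\<close>, \<open>u'\<close>, \<open>u'\<close>.\<close>
    have "foot a c u = p" by (rule foot_eqI[OF os(2) au(1) an(1) p(1)]) (use pc col_sym in blast)
    moreover have "foot c b p = r"
      by (rule foot_eqI[OF opp_sym[OF os(3)] col_sym[OF pc(1)] cn(1) _ br(1)]) (use rc ln_sym in metis)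
    moreover have "foot b c' r = u'"
      by (rule foot_eqI[OF os(5) br(1) rb[symmetric] u'r]) (use c' col_sym in blast)
    moreover have "foot c' a u' = u'"
      by (rule foot_fix[OF opp_sym[OF os(4)]]) (use c'(2) col_sym Q in \<open>unfold quad_def, blast\<close>)
    moreover have "foot a b u' = u'" by (rule foot_fix[OF os(1) f'(3)])
    ultimately show ?thesis by (simp add: t_def round_trip_def)
  qed
  have col: "collineation \<Gamma> (extend t)" unfolding t_def
    by (rule extend_collineation[where h = "round_trip a b c' c"])
      (use round_trip_quad round_trip_inverse round_trip_col os in \<open>blast\<close>)+
  have td: "t d = d" using tfix f(1) c(2) cc'(1) col_sym by blast
  have res: "ln d (t x) = ln d x" if "x \<in> Q" "d \<sim> x" "d \<noteq> x" for x
  proof -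
    have "ln d (round_trip a b c c' x) = ln d (round_trip a b c c x)"
      by (rule round_trip_cong(1)[OF os that(1,1) f(1) c(2) cc'(1) c(2,2) dc dc refl cc'(2) that(2,2,3,3) refl os(2,3,2,3)])
    then show ?thesis using round_trip_same[OF os(1-3) that(1)] by (simp add: t_def)
  qed
  have "extend t \<in> root_group1 \<Gamma> d q n"
    unfolding root_group1_def
  proof (intro CollectI conjI ballI impI)
    show "collineation \<Gamma> (extend t)" by (rule col)
    show "extend t ` l = l" if "l \<in> lines \<Gamma>" "d \<in> l" for l
      by (rule fixes_lines[OF col f(1) _ _ that]) (use td res f(1) in \<open>auto simp: extend_def\<close>)
    fix x assume x: "x \<in> line_through \<Gamma> d q \<union> line_through \<Gamma> d n"
    have dn: "d \<noteq> n" using f by auto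
    have "c \<sim> d" "c \<sim> q" "c \<sim> n" "c' \<sim> d" "c' \<sim> q" "c' \<sim> n"
      using qc c(2) cc'(1) col_sym by blast+
    then have "x \<in> Q \<and> c \<sim> x \<and> c' \<sim> x"
      using x line_through_\<Gamma>[OF f(1,2,5,17)] line_through_\<Gamma>[OF f(1,4,14) dn]
        col_ln[OF _ _ f(5,17), of _ x] col_ln[OF _ _ f(14) dn, of _ x]
        ln_sub_Q[OF f(1,2,5,17)] ln_sub_Q[OF f(1,4,14) dn] by auto
    then show "extend t x = x" using tfix by (simp add: extend_def)
  qed
  moreover have "extend t u = u'" using \<open>t u = u'\<close> f(3) by (simp add: extend_def)
  ultimately show ?thesis by blast
qed

text \<open>An apartment containing the root is determined by its fourth vertex, and the elations
  carry any such vertex to any other.\<close>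

lemma first_kind_transitive:
  assumes o: "ordinary_quadrangle \<Gamma> d q u n"
  shows "transitive_on_apartments \<Gamma> (root_group1 \<Gamma> d q n) (root1 \<Gamma> d q n)"
  unfolding transitive_on_apartments_def
proof (intro ballI impI)
  note f = quadrangle_facts[OF o]
  fix A B assume AB: "A \<in> apartments \<Gamma>" "B \<in> apartments \<Gamma>"
    and c: "figure_contains A (root1 \<Gamma> d q n) \<and> figure_contains B (root1 \<Gamma> d q n)"
  have *: "\<exists>v. ordinary_quadrangle \<Gamma> d q v n \<and> X = quad_figure \<Gamma> d q v n"
    if X: "X \<in> apartments \<Gamma>" "figure_contains X (root1 \<Gamma> d q n)" for X
  proof -
    have m: "d \<in> fst X" "q \<in> fst X" "n \<in> fst X" using X(2) by (auto simp: figure_contains_def root1_def)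
    obtain v n' where v: "ordinary_quadrangle \<Gamma> d q v n'" "X = quad_figure \<Gamma> d q v n'"
      using apartment_obtain[OF X(1) m(1,2)] f(1,2,5,17) collinear_\<Gamma> by blast
    have "n \<in> {d, q, v, n'}" using m(3) v(2) by (simp add: quad_figure_def)
    moreover have "n \<noteq> d" "n \<noteq> q" "n \<noteq> v"
      using f(10,14,20) quadrangle_facts(9,5)[OF v(1)] f(5) col_refl[OF Q_pts[OF f(2)]] by metis+
    ultimately show ?thesis using v by auto
  qed
  obtain u1 u2 where u: "ordinary_quadrangle \<Gamma> d q u1 n" "A = quad_figure \<Gamma> d q u1 n"
    "ordinary_quadrangle \<Gamma> d q u2 n" "B = quad_figure \<Gamma> d q u2 n"
    using * AB c by metis
  obtain g where g: "g \<in> root_group1 \<Gamma> d q n" "g u1 = u2"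
    using first_kind_elation[OF u(1,3)] by blast
  have fx: "g x = x" if "x \<in> line_through \<Gamma> d q \<union> line_through \<Gamma> d n" for x
    using g(1) that by (simp add: root_group1_def)
  have "g d = d" "g q = q" "g n = n"
    using fx[of d] fx[of q] fx[of n] line_through_\<Gamma>[OF f(1,2,5,17)] line_through_\<Gamma>[OF f(1,4,14)] f(17,20)
      ln[OF f(5,17)] ln[OF f(14)] by auto
  then have "figure_image g A = B"
    using figure_image_quad_figure[OF _ u(1), of g] g u(2,4) by (simp add: root_group1_def)
  then show "\<exists>g\<in>root_group1 \<Gamma> d q n. figure_image g A = B" using g(1) by blast
qed

end

section \<open>Root elations of the second kind\<close>

text \<open>This is where thickness enters: besides the planes joining \<open>d q\<close> to
  \<open>a\<close> and to \<open>b\<close> there is a third plane through \<open>d q\<close>, and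
  \<open>c\<close> is found in it. Collinearity of \<open>c\<close> to \<open>n\<close> lets one of
  the two round trips fix \<open>n\<close>. The assumption is established in
  \<open>rank_three_third_plane\<close>.\<close>

locale thick_residual_quadrangle = residual_quadrangle +
  assumes third_plane: "\<lbrakk>d \<in> quad a b; q \<in> quad a b; n \<in> quad a b; d \<sim> q; d \<noteq> q; d \<sim> n; \<not> q \<sim> n\<rbrakk>
    \<Longrightarrow> \<exists>c. opp a c \<and> opp b c \<and> d \<sim> c \<and> q \<sim> c \<and> n \<sim> c"
begin

lemma not_col_shift:
  assumes "\<not> e \<sim> c" "e \<sim> d" "d \<sim> c" "c' \<in> ln d c" "c' \<noteq> d"
  shows "\<not> e \<sim> c'"
proof
  have "d \<noteq> c" using assms(1,2) by blast
  moreover assume "e \<sim> c'"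
  ultimately have "e \<sim> c" using col_ln'[OF assms(2) _ assms(3) _ assms(4,5)] by blast
  then show False using assms(1) by blast
qed

lemma opp_shift:
  assumes "opp e c" "e \<sim> d" "d \<sim> c" "c' \<in> ln d c" "c' \<noteq> d"
  shows "opp e c'"
proof -
  have n: "\<not> e \<sim> c" using assms(1) by (simp add: opp_def)
  then have "d \<noteq> c" using assms(2) by blast
  then have "c' \<in> points G" using ln_col[OF assms(3) _ assms(4,4)] col_pts by blast
  then show ?thesis using not_col_shift[OF n assms(2-5)] assms(1) by (simp add: opp_def)
qed

lemma opp_neq_quad: "opp a c \<Longrightarrow> x \<in> Q \<Longrightarrow> x \<noteq> c"
  using Q_cols unfolding opp_def by blast

text \<open>Since \<open>c\<^sub>1\<close> is collinear to \<open>n\<close>, the first round trip fixes \<open>n\<close>; the point \<open>c\<^sub>2'\<close> is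
  determined by \<open>n'\<close> through the requirement that \<open>an\<close> and \<open>an'\<close> be sent to the same line through
  \<open>b\<close>, along \<open>c\<^sub>2'\<close> and \<open>c\<^sub>2\<close> respectively. The points \<open>y\<close>, \<open>v\<close> and \<open>z\<close> are the intermediate points.\<close>

lemma second_kind_elation:
  assumes o: "ordinary_quadrangle \<Gamma> d q u n" and n': "n' \<in> ln d n" "n' \<noteq> d"
  shows "\<exists>g\<in>root_group2 \<Gamma> d q. g n = n'"
proof (cases "n = n'")
  case True
  then show ?thesis using id_root_groups(2) by (metis id_apply)
next
  case nn: False
  note f = quadrangle_facts[OF o]
  note Q = Q_cols[OF f(1)] Q_cols[OF f(2)] Q_cols[OF f(4)]
  have dn: "d \<noteq> n" using f by blast
  have n'Q: "n' \<in> Q" using ln_sub_Q[OF f(1,4,14) dn] n'(1) by blast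
  have nab: "\<not> a \<sim> b" "\<not> b \<sim> a" using ab col_sym unfolding opp_def by blast+
  have dn': "d \<sim> n'" "n' \<sim> n" using ln_col[OF f(14) dn] n'(1) ln[OF f(14) dn] by blast+
  have ndn': "n \<in> ln d n'" using ln_swap[OF f(14) dn n'] .
  have an: "a \<sim> n" "a \<noteq> n" "a \<sim> n'" "a \<noteq> n'" "b \<sim> n'"
    using Q Q_cols[OF n'Q] quad_neq[OF ab f(4)] quad_neq[OF ab n'Q] by auto
  obtain c1 where c1: "opp a c1" "opp b c1" "d \<sim> c1" "q \<sim> c1" "n \<sim> c1"
    using third_plane[OF f(1,2,4,5,17,14,10)] by blast
  have c1n: "q \<noteq> c1" "d \<noteq> c1" using opp_neq_quad c1(1) f(1,2) by blast+
  \<comment> \<open>On \<open>q c1\<close> only \<open>c1\<close> is collinear to \<open>n\<close>,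
    since \<open>n\<close> is not collinear to \<open>q\<close>. So \<open>c2\<close> is not
    collinear to \<open>n\<close>, as it must be if the second round trip is to move
    \<open>n\<close>.\<close>
  obtain c2 where c2: "c2 \<in> ln q c1" "c2 \<noteq> q" "c2 \<noteq> c1" using third_point[OF ln_line[OF c1(4) c1n(1)]] by blast
  have qc2: "q \<sim> c2" "c1 \<sim> c2" using ln_col[OF c1(4) c1n(1) _ c2(1)] ln[OF c1(4) c1n(1)] by blast+
  have lnq: "ln q c2 = ln q c1" using ln_cong[OF c1(4) c1n(1) c2(1,2)] .
  have dc2: "d \<sim> c2" using col_ln[OF f(5) c1(3,4) c1n(1) c2(1)] .
  have oc2: "opp a c2" "opp b c2" using opp_shift[OF _ _ c1(4) c2(1,2)] c1(1,2) Q by blast+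
  have nd_c2: "d \<noteq> c2" using opp_neq_quad[OF oc2(1) f(1)] .
  have nnc2: "\<not> n \<sim> c2"
  proof
    assume "n \<sim> c2"
    moreover have "q \<in> ln c1 c2" using ln_swap[of c1 q c2] c1(4) c1n(1) c2(1,3) ln_sym col_sym by metis
    ultimately have "n \<sim> q" using col_ln[OF c1(5) _ qc2(2) c2(3)[symmetric]] by blast
    then show False using f by blast
  qed
  have nac2: "\<not> c2 \<sim> a" "\<not> c2 \<sim> b" "\<not> a \<sim> c2" "\<not> b \<sim> c2" using oc2 col_sym unfolding opp_def by blast+
  \<comment> \<open>\<open>v\<close> and \<open>z\<close> follow the line \<open>a n'\<close> along
    \<open>c2\<close>. Although defined through \<open>c2\<close>, the point \<open>y\<close> is
    also the foot of \<open>n\<close> with respect to the future \<open>c2'\<close>: this will lie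
    on \<open>d c2\<close>, and \<open>y\<close> is collinear to \<open>d\<close> and
    \<open>c2\<close>.\<close>
  define v where "v = foot a c2 n'"
  define y where "y = foot a c2 n"
  define z where "z = foot c2 b v"
  have v: "v \<in> ln a n'" "c2 \<sim> v" "v \<in> quad a c2" "v \<in> quad c2 a"
    using foot_spec[OF oc2(1) an(3,4)] foot_quad[OF oc2(1) an(3,4)] quad_sym by (auto simp: v_def)
  have y: "y \<in> ln a n" "c2 \<sim> y" "y \<in> quad a c2"
    using foot_spec[OF oc2(1) an(1,2)] foot_quad[OF oc2(1) an(1,2)] by (auto simp: y_def)
  have vn: "v \<noteq> a" "v \<noteq> c2" using quad_neq[OF oc2(1) v(3)] by auto
  have yn: "y \<noteq> a" "y \<noteq> c2" using quad_neq[OF oc2(1) y(3)] by auto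
  have z: "z \<in> ln c2 v" "b \<sim> z" "z \<in> quad c2 b"
    using foot_spec[OF opp_sym[OF oc2(2)] v(2)] foot_quad[OF opp_sym[OF oc2(2)] v(2)] vn(2) by (auto simp: z_def)
  have zn: "z \<noteq> c2" "z \<noteq> b" using quad_neq[OF opp_sym[OF oc2(2)] z(3)] by auto
  have c2z: "c2 \<sim> z" "z \<sim> v" using ln_col[OF v(2) vn(2)[symmetric] _ z(1)] ln_col[OF v(2) vn(2)[symmetric] z(1)] ln[OF v(2) vn(2)[symmetric]] by auto
  have vz: "v \<in> ln c2 z" using ln_swap[OF v(2) vn(2)[symmetric] z(1) zn(1)] .
  have av: "a \<sim> v" "a \<sim> y" using v(3) y(3) by (auto simp: quad_def)
  have dv: "d \<sim> v" "d \<sim> y" using col_ln[OF _ dn'(1) an(3,4) v(1)] col_ln[OF _ f(14) an(1,2) y(1)] Q by auto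
  have dz: "d \<sim> z" using col_ln[OF dc2 dv(1) v(2) vn(2)[symmetric] z(1)] .
  have nda: "n \<notin> ln d a"
  proof
    assume "n \<in> ln d a"
    then have "b \<sim> a" using col_ln'[of b d n a] Q quad_neq[OF ab f(1)] dn by metis
    then show False using nab by blast
  qed
  \<comment> \<open>\<open>n\<close> and \<open>n'\<close> lie on one line through \<open>d\<close>;
    by \<open>foot_cong_arg\<close>, so do their feet.\<close>
  have dy: "d \<noteq> y" "ln d y = ln d v"
  proof -
    have "ln d n = ln d n'" using ln_cong[OF f(14) dn n'] by simp
    then show "ln d y = ln d v" "d \<noteq> y"
      using foot_cong_arg(1,2)[OF oc2(1) an(1,3) _ dc2 f(14) dn'(1) _ dn n'(2)[symmetric] _ nda]
        Q quad_neq[OF ab f(1)] unfolding v_def y_def by auto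
  qed
  have ndv: "d \<noteq> v"
  proof
    assume "d = v"
    then have "n' \<in> ln a d" using ln_swap[OF an(3,4) v(1) vn(1)] by simp
    then have "b \<sim> a" using col_ln'[of b d n' a] Q an(5) quad_neq[OF ab f(1)] n'(2) ln_sym by metis
    then show False using nab by blast
  qed
  have yv: "y \<in> ln d v" using ln_right[OF dv(2) dy(1)] dy(2) by simp
  have ynv: "y \<noteq> n"  using nnc2 y(2) col_sym by blast
  have nby: "\<not> b \<sim> y"
  proof
    assume "b \<sim> y"
    then have "y = n" using foot_eqI[OF ab an(1,2) y(1)] foot_fix[OF ab f(4)] by simp
    then show False using ynv by blast
  qed
  have yz: "y \<noteq> z" using z(2) nby by blast
  have nc2v: "\<not> d = z"
  proof
    assume "d = z"
    then have "v \<in> ln d c2" using vz ln_sym by metis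
    then have "c2 \<in> ln d v" using ln_swap[OF dc2 nd_c2 _ ndv[symmetric]] by simp
    then have "a \<sim> c2" using col_ln[OF _ av(1) dv(1) ndv] Q by blast
    then show False using nac2 by blast
  qed
  have c2y: "c2 \<noteq> y" using yn by simp
  have vy: "v \<in> ln y d" using ln_right[OF dv(1) ndv] dy(2) ln_sym by metis
  have zy: "z \<sim> y" 
    using col_ln[OF col_sym[OF dz] c2z(2) dv(1) ndv yv] .
  have "{y, d, z, c2} \<subseteq> points G" using y(2) dz col_pts by blast
  then have "clique {y, d, z, c2}"
    using zy dv(2) dz dc2 y(2) c2z(1) col_sym col_refl unfolding clique_def by simp
  moreover have "v \<in> ln z c2" using vz ln_sym by metis
  \<comment> \<open>The lines \<open>y d\<close> and \<open>z c2\<close> share \<open>v\<close>, so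
    Pasch gives a common point of \<open>y z\<close> and \<open>d c2\<close>. On \<open>y z\<close>
    it carries \<open>y\<close> to \<open>z\<close>; on \<open>d c2\<close> it keeps the action at
    \<open>d\<close> trivial.\<close>
  ultimately obtain c2' where c2': "c2' \<in> ln y z" "c2' \<in> ln d c2"
    using pasch[of y d z c2 v] vy dy(1) zn(1) yz nd_c2 by metis
  have nvz: "v \<noteq> z"
  proof
    assume vzz: "v = z"
    then have "v = n'" using foot_eqI[OF ab an(3,4) v(1)] z(2) foot_fix[OF ab n'Q] by simp
    then have "c2 \<sim> n'" using v(2) by simp
    then have "c2 \<sim> n" using col_ln[OF col_sym[OF dc2] _ dn'(1) n'(2)[symmetric] ndn'] by blast
    then show False using nnc2 col_sym by blast
  qed
  have c2'd: "c2' \<noteq> d"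
  proof
    assume "c2' = d"
    then have "d \<in> ln y z" using c2'(1) by simp
    then have "z \<in> ln y d" using ln_swap[OF col_sym[OF zy] yz] dy(1) by simp
    then have "a \<sim> z" using col_ln[OF av(2) _ col_sym[OF dv(2)] dy(1)[symmetric]] Q by blast
    moreover have "c2 \<in> ln v z" using ln_swap[of v c2 z] v(2) vn(2) z(1) nvz ln_sym col_sym by metis
    ultimately have "a \<sim> c2" using col_ln[OF av(1) _ col_sym[OF c2z(2)] nvz] by blast
    then show False using nac2 by blast
  qed
  have dc2': "d \<sim> c2'" "ln d c2' = ln d c2"
    using ln_col[OF dc2 nd_c2 ln_left[OF dc2 nd_c2] c2'(2)] ln_cong[OF dc2 nd_c2 c2'(2) c2'd] by auto
  have oc2': "opp a c2'" "opp b c2'" using opp_shift[OF _ _ dc2 c2'(2) c2'd] oc2 Q by blast+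
  have qc2': "q \<sim> c2'" using col_ln[OF f(11) qc2(1) dc2 nd_c2 c2'(2)] .
  have nqc2': "q \<noteq> c2'" "d \<noteq> c2'" using opp_neq_quad[OF oc2'(1)] f(1,2) by blast+
  have c1c2': "c1 \<sim> c2'" using col_ln[OF col_sym[OF c1(3)] qc2(2) dc2 nd_c2 c2'(2)] .
  have "{q, c1, c2', d} \<subseteq> points G" using qc2' c1(3) col_pts by blast
  then have "clique {q, c1, c2', d}"
    using qc2' c1(3,4) c1c2' dc2' f(5) col_sym col_refl unfolding clique_def by simp
  moreover have "c2 \<in> ln c2' d" using ln_swap[OF dc2 nd_c2 c2'(2) c2'd] ln_sym by metis
  \<comment> \<open>This closes the quadrilateral in the plane of \<open>d\<close>, \<open>q\<close>
    and \<open>c1\<close>: the lines \<open>q c1\<close> and \<open>d c2'\<close> share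
    \<open>c2\<close>, so \<open>q c2'\<close> and \<open>d c1\<close> meet.\<close>
  ultimately obtain c1' where c1': "c1' \<in> ln q c2'" "c1' \<in> ln d c1"
    using pasch[of q c1 c2' d c2] c2(1) c1n nqc2' c2'd ln_sym by metis
  have c1'd: "c1' \<noteq> d"
  proof
    assume "c1' = d"
    then have "c2' \<in> ln q d" using ln_swap[OF qc2' nqc2'(1) c1'(1)] f(17) by simp
    then have "a \<sim> c2'" using col_ln[OF _ _ f(11) f(17)[symmetric]] Q by blast
    then show False using oc2' unfolding opp_def by blast
  qed
  have dc1': "d \<sim> c1'" "ln d c1' = ln d c1"
    using ln_col[OF c1(3) c1n(2) ln_left[OF c1(3) c1n(2)] c1'(2)] ln_cong[OF c1(3) c1n(2) c1'(2) c1'd] by auto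
  have oc1': "opp a c1'" "opp b c1'" using opp_shift[OF _ _ c1(3) c1'(2) c1'd] c1(1,2) Q by blast+
  have nc1': "q \<noteq> c1'" "d \<noteq> c1'" using opp_neq_quad[OF oc1'(1)] f(1,2) by blast+
  have qc1': "q \<sim> c1'" "ln q c1' = ln q c2'"
    using ln_col[OF qc2' nqc2'(1) ln_left[OF qc2' nqc2'(1)] c1'(1)] ln_cong[OF qc2' nqc2'(1) c1'(1) nc1'(1)[symmetric]] by auto
  have nc1'col: "n \<sim> c1'" using col_ln[OF f(8) c1(5,3) c1n(2) c1'(2)] .
  note os1 = ab c1(1,2) oc1'
  note os1' = ab oc1' c1(1,2)
  note os2 = ab oc2' oc2
  note os2' = ab oc2 oc2'
  define s where "s = round_trip a b c1 c1'"
  define s' where "s' = round_trip a b c1' c1"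
  define t where "t = round_trip a b c2' c2"
  define t' where "t' = round_trip a b c2 c2'"
  have sQ: "x \<in> Q \<Longrightarrow> s x \<in> Q" "x \<in> Q \<Longrightarrow> s' x \<in> Q" "x \<in> Q \<Longrightarrow> t x \<in> Q" "x \<in> Q \<Longrightarrow> t' x \<in> Q" for x
    unfolding s_def s'_def t_def t'_def by (rule round_trip_quad[OF os1] round_trip_quad[OF os1'] round_trip_quad[OF os2] round_trip_quad[OF os2']; assumption)+
  have inv: "x \<in> Q \<Longrightarrow> s (s' x) = x" "x \<in> Q \<Longrightarrow> s' (s x) = x" "x \<in> Q \<Longrightarrow> t (t' x) = x" "x \<in> Q \<Longrightarrow> t' (t x) = x" for x
    unfolding s_def s'_def t_def t'_def
    by (rule round_trip_inverse[OF os1] round_trip_inverse[OF os1'] round_trip_inverse[OF os2] round_trip_inverse[OF os2']; assumption)+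
  have cl: "s x \<sim> s y" "s' x \<sim> s' y" "t x \<sim> t y" "t' x \<sim> t' y" if "x \<in> Q" "y \<in> Q" "x \<sim> y" for x y
    unfolding s_def s'_def t_def t'_def
    by (rule round_trip_col[OF os1 that] round_trip_col[OF os1' that] round_trip_col[OF os2 that] round_trip_col[OF os2' that])+
  define g where "g x = t (s x)" for x
  have col: "collineation \<Gamma> (extend g)"
    by (rule extend_collineation[where h = "\<lambda>x. s' (t' x)"]) (simp_all add: g_def sQ inv cl)
  have sfix: "s x = x" if "x \<in> Q" "c1 \<sim> x" "c1' \<sim> x" for x
    unfolding s_def by (rule round_trip_fix[OF os1 that])
  have tfix: "t x = x" if "x \<in> Q" "c2' \<sim> x" "c2 \<sim> x" for x
    unfolding t_def by (rule round_trip_fix[OF os2 that])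
  have gfix: "g x = x" if "x \<in> ln d q" for x
  proof -
    have "x \<in> Q" using ln_sub_Q[OF f(1,2,5,17)] that by blast
    moreover have "e \<sim> x" if "d \<sim> e" "q \<sim> e" for e
      using col_ln[OF col_sym[OF that(1)] col_sym[OF that(2)] f(5,17) \<open>x \<in> ln d q\<close>] .
    ultimately show ?thesis
      using sfix tfix c1(3,4) dc1'(1) qc1'(1) dc2 qc2(1) dc2'(1) qc2' by (simp add: g_def)
  qed
  have resd: "ln d (g x) = ln d x" if x: "x \<in> Q" "d \<sim> x" "d \<noteq> x" for x
  proof -
    note A = round_trip_cong[OF os1 x(1,1) f(1) c1(3) dc1'(1) c1(3,3) c1n(2,2) refl dc1'(2) x(2,2,3,3) refl c1(1,2,1,2)]
    have 1: "ln d (s x) = ln d x" using A(1) round_trip_same[OF ab c1(1,2) x(1)] by (simp add: s_def)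
    have 2: "s x \<in> Q" "d \<sim> s x" "d \<noteq> s x" using A(2,3) sQ(1)[OF x(1)] by (simp_all add: s_def)
    have "ln d (t (s x)) = ln d (round_trip a b c2 c2 (s x))" unfolding t_def
      by (rule round_trip_cong(1)[OF os2 2(1,1) f(1) dc2'(1) dc2 dc2 dc2 nd_c2 nd_c2 dc2'(2) refl 2(2,2,3,3) refl oc2 oc2])
    then show ?thesis using round_trip_same[OF ab oc2 2(1)] 1 by (simp add: g_def)
  qed
  have resq: "ln q (g x) = ln q x" if x: "x \<in> Q" "q \<sim> x" "q \<noteq> x" for x
  proof -
    note qn = c2(2)[symmetric] nqc2'(1)
    have "ln q c1 = ln q c2" using lnq by simp
    \<comment> \<open>\<open>A\<close> says that on the lines through \<open>q\<close> the map
      \<open>s\<close> acts as \<open>t'\<close>. \<open>B\<close> compares \<open>t'\<close> with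
      itself and is recorded for the nondegeneracy of its values.\<close>
    note A = round_trip_cong[OF os1 x(1,1) f(2) c1(4) qc1'(1) qc2(1) qc2' qn this qc1'(2) x(2,2,3,3) refl os2'(2-)]
    note B = round_trip_cong[OF os2' x(1,1) f(2) qc2(1) qc2' qc2(1) qc2' qn refl refl x(2,2,3,3) refl os2'(2-)]
    note A' = A[folded s_def t'_def] and B' = B(2,3)[folded t'_def]
    \<comment> \<open>The points \<open>s x\<close> and \<open>t' x\<close> need not agree, only
      their joining lines with \<open>q\<close>; hence the congruence with two different
      arguments.\<close>
    have "ln q (t (s x)) = ln q (t (t' x))" unfolding t_def
      by (rule round_trip_cong(1)[OF os2 sQ(1)[OF x(1)] sQ(4)[OF x(1)] f(2) qc2' qc2(1) qc2' qc2(1) qn(2,1) refl refl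
          A'(3) B'(2) A'(2) B'(1) A'(1) os2(2-)])
    then show ?thesis using inv(3)[OF x(1)] by (simp add: g_def)
  qed
  have gd: "g d = d" "g q = q" using gfix ln[OF f(5,17)] by auto
  have c2'y: "c2' \<noteq> y" using av(2) oc2'(1) unfolding opp_def by blast
  have "g n = n'"
  proof -
    \<comment> \<open>After \<open>s\<close> has fixed \<open>n\<close>, the path of
      \<open>t\<close> runs \<open>n\<close>, \<open>y\<close>, \<open>z\<close>, \<open>z\<close>,
      \<open>v\<close>, \<open>n'\<close>.\<close>
    have sn: "s n = n" using sfix[OF f(4)] c1(5) nc1'col col_sym by blast
    have "c2' \<sim> y" using col_ln[OF col_sym[OF dv(2)] col_sym[OF y(2)] dc2 nd_c2 c2'(2)] col_sym by blast
    then have 1: "foot a c2' n = y" by (rule foot_eqI[OF oc2'(1) an(1,2) y(1)])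
    have "z \<in> ln y c2'" using ln_swap[OF col_sym[OF zy] yz c2'(1) c2'y] .
    then have 2: "foot c2' b y = z"
      by (intro foot_eqI[OF opp_sym[OF oc2'(2)] \<open>c2' \<sim> y\<close> c2'y _ z(2)]) (simp add: ln_sym)
    have 3: "foot b c2 z = z" by (rule foot_fix[OF oc2(2)]) (use z(3) quad_sym in blast)
    have 4: "foot c2 a z = v" by (rule foot_eqI[OF opp_sym[OF oc2(1)] c2z(1) zn(1)[symmetric] vz av(1)])
    have 5: "foot a b v = n'"
      by (rule foot_eqI[OF ab av(1) vn(1)[symmetric] ln_swap[OF an(3,4) v(1) vn(1)] an(5)])
    show ?thesis using sn 1 2 3 4 5 by (simp add: g_def t_def round_trip_def)
  qed
  moreover have "extend g \<in> root_group2 \<Gamma> d q"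
    unfolding root_group2_def
  proof (intro CollectI conjI ballI impI)
    show "collineation \<Gamma> (extend g)" by (rule col)
    show "extend g ` l = l" if "l \<in> lines \<Gamma>" "d \<in> l \<or> q \<in> l" for l
      using that(2)
    proof
      assume "d \<in> l"
      show ?thesis by (rule fixes_lines[OF col f(1) _ _ that(1) \<open>d \<in> l\<close>]) (use gd resd f(1) in \<open>auto simp: extend_def\<close>)
    next
      assume "q \<in> l"
      show ?thesis by (rule fixes_lines[OF col f(2) _ _ that(1) \<open>q \<in> l\<close>]) (use gd resq f(2) in \<open>auto simp: extend_def\<close>)
    qed
    show "extend g x = x" if "x \<in> line_through \<Gamma> d q" for x
      using that gfix line_through_\<Gamma>[OF f(1,2,5,17)] by (simp add: extend_def)
  qed
  ultimately show ?thesis using f(4) by (metis extend_def)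
qed

text \<open>The root fixes the lines \<open>d n\<close> and \<open>q u\<close>, along which the two
  remaining vertices of the apartment may vary. It suffices to move the vertex on
  \<open>d n\<close>: the other is the only point of \<open>q u\<close> collinear to it.\<close>

lemma second_kind_transitive:
  assumes o: "ordinary_quadrangle \<Gamma> d q u n"
  shows "transitive_on_apartments \<Gamma> (root_group2 \<Gamma> d q) (root2 \<Gamma> d q u n)"
  unfolding transitive_on_apartments_def
proof (intro ballI impI)
  note f = quadrangle_facts[OF o]
  have dn: "d \<noteq> n" using f by blast
  note lt = line_through_\<Gamma>[OF f(1,2,5,17)] line_through_\<Gamma>[OF f(1,4,14) dn] line_through_\<Gamma>[OF f(2,3,6,18)]
  fix A B assume AB: "A \<in> apartments \<Gamma>" "B \<in> apartments \<Gamma>"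
    and c: "figure_contains A (root2 \<Gamma> d q u n) \<and> figure_contains B (root2 \<Gamma> d q u n)"
  have *: "\<exists>v w. ordinary_quadrangle \<Gamma> d q v w \<and> X = quad_figure \<Gamma> d q v w \<and> v \<in> ln q u \<and> w \<in> ln d n"
    if X: "X \<in> apartments \<Gamma>" "figure_contains X (root2 \<Gamma> d q u n)" for X
  proof -
    have m: "d \<in> fst X" "q \<in> fst X" and ml: "ln d n \<in> snd X" "ln q u \<in> snd X"
      using X(2) lt by (auto simp: figure_contains_def root2_def)
    obtain v w where v: "ordinary_quadrangle \<Gamma> d q v w" "X = quad_figure \<Gamma> d q v w"
      using apartment_obtain[OF X(1) m(1,2)] f(1,2,5,17) collinear_\<Gamma> by blast
    note h = quadrangle_facts[OF v(1)]
    note lt' = line_through_\<Gamma>[OF h(1,2,5,17)] line_through_\<Gamma>[OF h(2,3,6,18)] line_through_\<Gamma>[OF h(3,4,7,19)]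
      line_through_\<Gamma>[OF h(4,1,8,20)]
    \<comment> \<open>A priori each line of the root could be any side of the apartment;
      non-collinear pairs of vertices exclude all but one.\<close>
    have l: "ln d n \<in> {ln d q, ln q v, ln v w, ln w d}" "ln q u \<in> {ln d q, ln q v, ln v w, ln w d}"
      using ml v(2) lt' by (auto simp: quad_figure_def)
    have "ln d n \<noteq> ln d q" using ln_col[OF f(5,17)] ln_right[OF f(14) dn] ln_right[OF f(5,17)] f(10) by metis
    moreover have "ln d n \<noteq> ln q v" using ln_col[OF h(6,18)] ln_right[OF h(6,18)] ln_left[OF f(14) dn] h(9) by metis
    moreover have "ln d n \<noteq> ln v w" using ln_col[OF h(7,19)] ln_left[OF h(7,19)] ln_left[OF f(14) dn] h(9) by metis
    ultimately have "w \<in> ln d n" using l(1) ln_left[OF h(8,20)] by auto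
    moreover have "ln q u \<noteq> ln d q" using ln_col[OF f(5,17)] ln_right[OF f(6,18)] ln_left[OF f(5,17)] f(9) by metis
    moreover have "ln q u \<noteq> ln w d" using ln_col[OF h(8,20)] ln_left[OF h(8,20)] ln_left[OF f(6,18)] h(10) by metis
    moreover have "ln q u \<noteq> ln v w" using ln_col[OF h(7,19)] ln_right[OF h(7,19)] ln_left[OF f(6,18)] h(10) by metis
    ultimately have "v \<in> ln q u" using l(2) ln_right[OF h(6,18)] by auto
    then show ?thesis using v \<open>w \<in> ln d n\<close> by blast
  qed
  obtain u1 n1 where A: "ordinary_quadrangle \<Gamma> d q u1 n1" "A = quad_figure \<Gamma> d q u1 n1" "u1 \<in> ln q u" "n1 \<in> ln d n"
    using * AB c by metis
  obtain u2 n2 where B: "ordinary_quadrangle \<Gamma> d q u2 n2" "B = quad_figure \<Gamma> d q u2 n2" "u2 \<in> ln q u" "n2 \<in> ln d n"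
    using * AB c by metis
  note h1 = quadrangle_facts[OF A(1)] and h2 = quadrangle_facts[OF B(1)]
  have "n2 \<in> ln d n1" using ln_cong[OF f(14) dn A(4) h1(20)] B(4) by simp
  then obtain g where g: "g \<in> root_group2 \<Gamma> d q" "g n1 = n2"
    using second_kind_elation[OF A(1)] h2(20) by blast
  have gc: "collineation \<Gamma> g" and gl: "l \<in> lines \<Gamma> \<Longrightarrow> q \<in> l \<Longrightarrow> g ` l = l" for l
    using g(1) by (auto simp: root_group2_def)
  have "g d = d" "g q = q"
    using g(1) lt(1) ln[OF f(5,17)] by (auto simp: root_group2_def)
  moreover have "g u1 = u2"
  proof -
    have "g ` ln q u = ln q u" by (rule gl[OF ln_in_\<Gamma>[OF f(2,3,6,18)] ln_left[OF f(6,18)]])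
    then have 1: "g u1 \<in> ln q u" using A(3) by blast
    have 2: "g ` line_through \<Gamma> u1 n1 = line_through \<Gamma> (g u1) n2"
      using collineation_line_through[OF gc h1(3,4,7,19)] g(2) by simp
    have p: "g permutes Q" and "bij_betw ((`) g) (lines \<Gamma>) (lines \<Gamma>)"
      using gc by (auto simp: collineation_def points_\<Gamma>)
    then have "g ` ln u1 n1 \<in> lines \<Gamma>" using bij_betwE ln_in_\<Gamma>[OF h1(3,4,7,19)] by blast
    then have "g u1 \<sim> n2" using line_col[of "g ` ln u1 n1" "g u1" "g n1"] lines_\<Gamma> ln[OF h1(7,19)] g(2) by blast
    then show ?thesis
      using ln_perp_unique[OF f(6,18) h2(16) 1 B(3)] col_sym h2(7) by blast
  qed
  ultimately have "figure_image g A = B"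
    using figure_image_quad_figure[OF gc A(1)] A(2) B(2) g(2) by simp
  then show "\<exists>g\<in>root_group2 \<Gamma> d q. figure_image g A = B" using g(1) by blast
qed

end

section \<open>Cones and dimension\<close>

text \<open>Generation is measured by subspaces of the ambient geometry. For a subspace
  \<open>S\<close> this agrees with generation inside \<open>induced G S\<close>, so a subspace and
  its hyperplane can be compared without changing geometry.\<close>

definition generates :: "'a geometry \<Rightarrow> 'a set \<Rightarrow> 'a set \<Rightarrow> bool" where
  "generates G B S \<longleftrightarrow> B \<subseteq> S \<and> (\<forall>T. subspace G T \<and> B \<subseteq> T \<longrightarrow> S \<subseteq> T)"

lemma subspace_Int: "subspace G S \<Longrightarrow> subspace G T \<Longrightarrow> subspace G (S \<inter> T)"
  unfolding subspace_def by blast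

lemma subspace_induced:
  assumes "subspace G S" shows "subspace (induced G S) T \<longleftrightarrow> subspace G T \<and> T \<subseteq> S"
proof
  assume T: "subspace (induced G S) T"
  then have TS: "T \<subseteq> S" by (simp add: subspace_def induced_def)
  have "l \<subseteq> T" if l: "l \<in> lines G" "x \<in> l \<inter> T" "y \<in> l \<inter> T" "x \<noteq> y" for l x y
  proof -
    have "l \<subseteq> S" using assms l TS unfolding subspace_def by blast
    then have "l \<in> lines (induced G S)" using l(1) by (simp add: induced_def)
    then show ?thesis using T l(2-) unfolding subspace_def by blast
  qed
  then show "subspace G T \<and> T \<subseteq> S" using TS assms unfolding subspace_def by blast
next
  assume "subspace G T \<and> T \<subseteq> S"
  then show "subspace (induced G S) T" unfolding subspace_def induced_def by simp
qed

lemma subspace_span_induced: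
  assumes "subspace G S" "B \<subseteq> S"
  shows "subspace_span (induced G S) B = S \<longleftrightarrow> generates G B S"
proof
  assume s: "subspace_span (induced G S) B = S"
  have "S \<subseteq> T" if "subspace G T" "B \<subseteq> T" for T
  proof -
    have "subspace (induced G S) (S \<inter> T)"
      using subspace_induced[OF assms(1)] subspace_Int[OF assms(1) that(1)] by blast
    then show ?thesis using s assms(2) that(2) unfolding subspace_span_def by blast
  qed
  then show "generates G B S" using assms(2) by (simp add: generates_def)
next
  assume g: "generates G B S"
  have "subspace (induced G S) S" using subspace_induced[OF assms(1)] assms(1) by blast
  then show "subspace_span (induced G S) B = S"
    using g assms(2) subspace_induced[OF assms(1)] unfolding subspace_span_def generates_def by blast
qed

lemma has_dimension_induced:
  assumes "subspace G S"
  shows "has_dimension (induced G S) d \<longleftrightarrow>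
    (\<exists>B. finite B \<and> generates G B S \<and> int (card B) = d + 1 \<and>
      (\<forall>C. finite C \<and> generates G C S \<longrightarrow> card B \<le> card C))"
proof -
  have "B \<subseteq> S \<and> finite B \<and> subspace_span (induced G S) B = S \<and> R \<longleftrightarrow> finite B \<and> generates G B S \<and> R"
    "(B \<subseteq> S \<longrightarrow> finite B \<and> subspace_span (induced G S) B = S \<longrightarrow> R) \<longleftrightarrow> (finite B \<and> generates G B S \<longrightarrow> R)" for B R
    using subspace_span_induced[OF assms, of B] unfolding generates_def by blast+
  moreover have "points (induced G S) = S" by (simp add: induced_def)
  ultimately show ?thesis unfolding has_dimension_def by (simp only: Bex_def Pow_iff simp_thms)
qed

lemma induced_induced: "T \<subseteq> S \<Longrightarrow> induced (induced G S) T = induced G T"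
  by (auto simp: induced_def)

context ranked_polar_space begin

definition cone :: "'a \<Rightarrow> 'a set \<Rightarrow> 'a set" where
  "cone p S = insert p (\<Union>s\<in>S. ln p s)"

lemma mem_perp_set: "y \<in> perp_set G X \<longleftrightarrow> y \<in> points G \<and> (\<forall>x\<in>X. x \<sim> y)"
  by (simp add: perp_set_def mem_perp)

lemma clique_col: "clique S \<Longrightarrow> x \<in> S \<Longrightarrow> y \<in> S \<Longrightarrow> x \<sim> y"
  by (simp add: clique_def)

lemma clique_subset: "clique S \<Longrightarrow> X \<subseteq> S \<Longrightarrow> clique X"
  unfolding clique_def by auto

lemma singular_iff: "singular_subspace G S \<longleftrightarrow> subspace G S \<and> clique S"
  by (auto simp: singular_subspace_def clique_def subspace_def)

lemma singular_col: "singular_subspace G S \<Longrightarrow> x \<in> S \<Longrightarrow> y \<in> S \<Longrightarrow> x \<sim> y"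
  by (simp add: singular_subspace_def)

lemma singular_ln: "singular_subspace G S \<Longrightarrow> x \<in> S \<Longrightarrow> y \<in> S \<Longrightarrow> x \<noteq> y \<Longrightarrow> ln x y \<subseteq> S"
  unfolding singular_iff using subspace_line[of S] ln[of x y] clique_col by blast

lemma line_singular: "l \<in> lines G \<Longrightarrow> singular_subspace G l"
proof -
  assume l: "l \<in> lines G"
  then have "clique l" using line_col line_sub unfolding clique_def by blast
  moreover have "m = l" if "m \<in> lines G" "x \<in> m \<inter> l" "y \<in> m \<inter> l" "x \<noteq> y" for m x y
    using line_unique[OF that(1) l] that by blast
  then have "subspace G l" using line_sub[OF l] unfolding subspace_def by blast
  ultimately show ?thesis by (simp add: singular_iff)
qed

lemma perp_Int_singular:
  assumes "singular_subspace G S" "b \<in> points G"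
  shows "singular_subspace G {x \<in> S. b \<sim> x}"
proof -
  have "{x \<in> S. b \<sim> x} = S \<inter> perp G b" using mem_perp by auto
  then have "subspace G {x \<in> S. b \<sim> x}" using subspace_Int[OF _ perp_subspace[OF assms(2)], of S] assms(1)
    unfolding singular_iff by simp
  then show ?thesis using assms(1) by (auto simp: singular_iff clique_def)
qed

lemma cone_col:
  assumes "\<And>s. s \<in> S \<Longrightarrow> e \<sim> s" "e \<sim> p" "\<And>s. s \<in> S \<Longrightarrow> p \<sim> s" "p \<notin> S" "x \<in> cone p S"
  shows "e \<sim> x"
  using assms(5) unfolding cone_def
proof (elim insertE UN_E)
  fix s assume s: "s \<in> S" "x \<in> ln p s"
  then have "p \<noteq> s" using assms(4) by blast
  then show ?thesis using col_ln[OF assms(2,1,3) _ s(2)] s(1) by blast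
qed (use assms in simp)

lemma cone_clique:
  assumes "clique S" "p \<in> points G" "\<And>s. s \<in> S \<Longrightarrow> p \<sim> s" "p \<notin> S"
  shows "clique (cone p S)"
proof -
  have 1: "e \<sim> x" if "e \<in> insert p S" "x \<in> cone p S" for e x
    by (rule cone_col[of S e p x]) (use that assms(3,4) clique_col[OF assms(1)] col_refl[OF assms(2)] col_sym in blast)+
  have 2: "x \<sim> y" if "x \<in> cone p S" "y \<in> cone p S" for x y
    by (rule cone_col[of S x p y]) (use that 1 assms(3,4) col_sym in blast)+
  then show ?thesis using col_pts unfolding clique_def by blast
qed

lemma cone_line:
  assumes S: "singular_subspace G S" and p: "p \<in> points G" "\<And>s. s \<in> S \<Longrightarrow> p \<sim> s" "p \<notin> S"
    and s: "s \<in> S" "t \<in> S" "x \<in> ln p s" "y \<in> ln p t" and z: "x \<noteq> y" "z \<in> ln x y"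
  shows "z \<in> cone p S"
proof -
  have cl: "clique (cone p S)" using cone_clique S p by (simp add: singular_iff)
  have ps: "p \<sim> s" "p \<noteq> s" "p \<sim> t" "p \<noteq> t" using p s by auto
  have in_cone: "v \<in> cone p S" if "v \<in> insert p (S \<union> ln p s \<union> ln p t)" for v
    using that s p(2,3) ln_right[of p v] unfolding cone_def by blast
  note cc = clique_col[OF cl in_cone in_cone]
  have xy: "x \<sim> y" by (rule cc) (use s in auto)
  consider "x = p" | "y = p" | "s = t" "x \<noteq> p" | "z = p" | "z = x" | "z = y"
    | "x \<noteq> p" "y \<noteq> p" "s \<noteq> t" "z \<noteq> p" "z \<noteq> x" "z \<noteq> y" by blast
  then show ?thesis
  proof cases
    case 1
    then have "ln x y = ln p t" using ln_cong[OF ps(3,4) s(4)] z(1) by simp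
    then show ?thesis using z(2) in_cone by blast
  next
    case 2
    then have "ln x y = ln p s" using ln_cong[OF ps(1,2) s(3)] z(1) ln_sym by metis
    then show ?thesis using z(2) in_cone by blast
  next
    case 3
    then have "ln x y = ln p s" using ln_eqI[OF ln_line[OF ps(1,2)] s(3) _ z(1)] s(4) by simp
    then show ?thesis using z(2) in_cone by blast
  next
    case 7
    have e: "v \<sim> z" if "v \<in> insert p (S \<union> ln p s \<union> ln p t)" for v
      using col_ln[OF cc cc xy z] that s by blast
    have zz: "z \<sim> z" using ln_col[OF xy z(1) z(2,2)] .
    have all: "u \<sim> v" if "u = z \<or> u \<in> insert p (S \<union> ln p s \<union> ln p t)"
      "v = z \<or> v \<in> insert p (S \<union> ln p s \<union> ln p t)" for u v
      using that(1)
    proof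
      assume "u = z"
      then show ?thesis using that(2) zz col_sym[OF e] by metis
    next
      assume "u \<in> insert p (S \<union> ln p s \<union> ln p t)"
      then show ?thesis using that(2) e cc by metis
    qed
    have cliq: "clique X" if "X \<subseteq> insert z (insert p (S \<union> ln p s \<union> ln p t))" for X
    proof -
      have "u \<sim> v" if "u \<in> X" "v \<in> X" for u v
        by (rule all) (use that \<open>X \<subseteq> _\<close> in auto)
      then show ?thesis using col_pts unfolding clique_def by auto
    qed
    have st: "s \<sim> t" by (rule cc) (use s in auto)
    have xz: "x \<in> ln y z" "y \<in> ln x z" using ln_swap[OF xy z 7(5)] ln_swap[of y x z] col_sym[OF xy] z(1,2) 7(6) ln_sym by metis+
    have lnst: "ln s t \<subseteq> S" using singular_ln[OF S s(1,2) 7(3)] .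
    have fin: "z \<in> cone p S" if "w \<in> ln p z" "w \<in> S" for w
    proof -
      have "p \<sim> z" using e by blast
      then have "z \<in> ln p w" using ln_swap[of p z w] that p(3) 7(4) by metis
      then show ?thesis using that(2) by (auto simp: cone_def)
    qed
    show ?thesis
    proof (cases "x = s")
      case True
      have "y \<in> ln p t" "y \<in> ln z s" using s(4) xz(2) True ln_sym by metis+
      then obtain w where w: "w \<in> ln p z" "w \<in> ln t s"
        using pasch[of p t z s y] cliq[of "{p, t, z, s}"] ps(4) 7 True s(1,2) by blast
      then show ?thesis using fin lnst ln_sym by blast
    next
      case xs: False
      show ?thesis
      proof (cases "y = t")
        case True
        have "x \<in> ln p s" "x \<in> ln z t" using s(3) xz(1) True ln_sym by metis+
        then obtain w where w: "w \<in> ln p z" "w \<in> ln s t"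
          using pasch[of p s z t x] cliq[of "{p, s, z, t}"] ps(2) 7 True s(1,2) by blast
        then show ?thesis using fin lnst by blast
      next
        case yt: False
        have "p \<in> ln x s" "p \<in> ln y t"
          using ln_swap[of s p x] ln_swap[of t p y] ps s(3,4) xs yt col_sym ln_sym by metis+
        then obtain w where w: "w \<in> ln x y" "w \<in> ln s t"
          using pasch[of x s y t p] cliq[of "{x, s, y, t}"] xs yt z(1) 7(3) s by blast
        show ?thesis
        proof (cases "z = w")
          case True
          then show ?thesis using w(2) lnst in_cone by blast
        next
          case zw: False
          have "s \<noteq> w"
          proof
            assume "s = w"
            then have "ln x y = ln p s"
              using ln_eqI[OF ln_line[OF xy z(1)] ln_left[OF xy z(1)] _ xs] w(1)
                ln_eqI[OF ln_line[OF ps(1,2)] s(3) ln_right[OF ps(1,2)] xs] by simp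
            then have "y \<in> ln p s" using ln_right[OF xy z(1)] by simp
            then have "ln p s = ln p t" using ln_cong[OF ps(1,2) _ 7(2)] ln_cong[OF ps(3,4) s(4) 7(2)] by simp
            then have "t \<in> ln p s" using ln_right[OF ps(3,4)] by simp
            then have "ln s t = ln p s" using ln_eqI[OF ln_line[OF ps(1,2)] ln_right[OF ps(1,2)] _ 7(3)] by simp
            then show False using lnst ln_left[OF ps(1,2)] p(3) by blast
          qed
          moreover have "x \<in> ln z w"
            using ln_eqI[OF ln_line[OF xy z(1)] z(2) w(1) zw] ln_left[OF xy z(1)] by simp
          ultimately obtain w' where "w' \<in> ln p z" "w' \<in> ln s w"
            using pasch[of p s z w x] cliq[of "{p, s, z, w}"] ps(2) zw 7(4) s w(2) lnst by blast
          moreover have "ln s w \<subseteq> S"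
            using singular_ln[OF S s(1) _ \<open>s \<noteq> w\<close>] w(2) lnst by blast
          ultimately show ?thesis using fin by blast
        qed
      qed
    qed
  qed (use in_cone s in auto)
qed

lemma cone_singular:
  assumes S: "singular_subspace G S" and p: "p \<in> points G" "\<And>s. s \<in> S \<Longrightarrow> p \<sim> s" "p \<notin> S"
  shows "singular_subspace G (cone p S)"
proof -
  have cl: "clique (cone p S)" using cone_clique S p by (simp add: singular_iff)
  have "l \<subseteq> cone p S" if l: "l \<in> lines G" "x \<in> l \<inter> cone p S" "y \<in> l \<inter> cone p S" "x \<noteq> y" for l x y
  proof
    fix z assume "z \<in> l"
    then have z: "z \<in> ln x y" using ln_eqI[of l x y] l by simp
    show "z \<in> cone p S"
    proof (cases "S = {}")
      case True
      then show ?thesis using l by (simp add: cone_def)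
    next
      case False
      have ex: "\<exists>s\<in>S. v \<in> ln p s" if "v \<in> cone p S" for v
      proof (cases "v = p")
        case True
        then show ?thesis using False p(2,3) ln_left[of p] by blast
      next
        case False
        then show ?thesis using that by (auto simp: cone_def)
      qed
      then show ?thesis using cone_line[OF S p _ _ _ _ l(4) z] l(2,3) by blast
    qed
  qed
  then show ?thesis using cl unfolding singular_iff subspace_def clique_def by blast
qed

lemma cone_hyperplane:
  assumes "singular_subspace G S" "b \<in> points G" "p \<in> S" "\<not> b \<sim> p"
  shows "cone p {x \<in> S. b \<sim> x} = S"
proof (intro equalityI subsetI)
  fix x assume "x \<in> cone p {x \<in> S. b \<sim> x}"
  then consider "x = p" | s where "s \<in> S" "b \<sim> s" "x \<in> ln p s" by (auto simp: cone_def)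
  then show "x \<in> S"
  proof cases
    case 2
    then show ?thesis using singular_ln[OF assms(1,3), of s] assms(4) by blast
  qed (use assms in simp)
next
  fix x assume x: "x \<in> S"
  show "x \<in> cone p {x \<in> S. b \<sim> x}"
  proof (cases "x = p")
    case False
    have px: "p \<sim> x" using singular_col[OF assms(1,3) x] .
    obtain h where h: "h \<in> ln p x" "b \<sim> h" using perp_meets[OF assms(2) ln_line[OF px]] False by blast
    then have "h \<in> S" using singular_ln[OF assms(1,3) x] False by blast
    moreover have "x \<in> ln p h" using ln_swap[OF px _ h(1)] h(2) assms(4) False by blast
    ultimately show ?thesis using h(2) by (auto simp: cone_def)
  qed (simp add: cone_def)
qed

lemma perp_Int_cone:
  assumes "b \<in> points G" "\<not> b \<sim> p" "\<And>s. s \<in> S \<Longrightarrow> p \<sim> s" "\<And>s. s \<in> S \<Longrightarrow> b \<sim> s"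
  shows "{x \<in> cone p S. b \<sim> x} = S"
proof (intro equalityI subsetI)
  fix x assume "x \<in> {x \<in> cone p S. b \<sim> x}"
  then obtain s where s: "s \<in> S" "x \<in> ln p s" "b \<sim> x" using assms(2) by (auto simp: cone_def)
  have ps: "p \<sim> s" "p \<noteq> s" using s(1) assms by auto
  have "x = s" using ln_perp_unique[OF ps assms(2) s(2) ln_right[OF ps] s(3) assms(4)[OF s(1)]] .
  then show "x \<in> S" using s by simp
next
  fix x assume x: "x \<in> S"
  then have "p \<sim> x" "p \<noteq> x" using assms by auto
  then show "x \<in> {x \<in> cone p S. b \<sim> x}" using x assms(4) ln_right by (auto simp: cone_def)
qed

lemma generates_insert:
  assumes S: "singular_subspace G S" "b \<in> points G" "p \<in> S" "\<not> b \<sim> p"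
    and B: "generates G B {x \<in> S. b \<sim> x}"
  shows "generates G (insert p B) S"
  unfolding generates_def
proof (intro conjI allI impI)
  show "insert p B \<subseteq> S" using B S(3) by (auto simp: generates_def)
  fix T assume T: "subspace G T \<and> insert p B \<subseteq> T"
  then have H: "{x \<in> S. b \<sim> x} \<subseteq> T" using B by (simp add: generates_def)
  have "ln p s \<subseteq> T" if "s \<in> S" "b \<sim> s" for s
  proof -
    have "p \<sim> s" "p \<noteq> s" using that S singular_col[OF S(1)] by auto
    then show ?thesis using subspace_line[of T "ln p s" p s] ln[of p s] T H that by blast
  qed
  then have "cone p {x \<in> S. b \<sim> x} \<subseteq> T" using T by (auto simp: cone_def)
  then show "S \<subseteq> T" using cone_hyperplane[OF S] by simp
qed

text \<open>Projecting a generating set from one of its points outside the hyperplane generates the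
  hyperplane; no exchange lemma is needed.\<close>

lemma generates_project:
  assumes S: "singular_subspace G S" "b \<in> points G" "p \<in> S" "\<not> b \<sim> p"
    and C: "finite C" "generates G C S"
  shows "\<exists>B. finite B \<and> generates G B {x \<in> S. b \<sim> x} \<and> card B < card C"
proof -
  let ?H = "{x \<in> S. b \<sim> x}"
  have Hs: "singular_subspace G ?H" by (rule perp_Int_singular[OF S(1,2)])
  have CS: "C \<subseteq> S" using C(2) by (simp add: generates_def)
  obtain c where c: "c \<in> C" "\<not> b \<sim> c"
  proof (rule ccontr)
    assume "\<not> thesis"
    then have "C \<subseteq> ?H" using that CS by blast
    then have "S \<subseteq> ?H" using C(2) Hs unfolding generates_def singular_iff by blast
    then show False using S(3,4) by blast
  qed
  have cS: "c \<in> S" using c CS by blast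
  have ocb: "opp c b" using c(2) S(2) cS col_sym S(1) unfolding opp_def singular_iff subspace_def by blast
  define B where "B = foot c b ` (C - {c})"
  have pc: "foot c b y \<in> ln c y \<and> b \<sim> foot c b y \<and> foot c b y \<in> S" if "y \<in> C - {c}" for y
  proof -
    have cy: "c \<sim> y" "c \<noteq> y" using that CS singular_col[OF S(1) cS] by auto
    then show ?thesis using foot_spec[OF ocb cy] singular_ln[OF S(1) cS, of y] that CS by blast
  qed
  have "generates G B ?H" unfolding generates_def
  proof (intro conjI allI impI)
    show "B \<subseteq> ?H" using pc by (auto simp: B_def)
    fix T assume T: "subspace G T \<and> B \<subseteq> T"
    define T' where "T' = T \<inter> ?H"
    have T's: "singular_subspace G T'"
      using subspace_Int T Hs unfolding T'_def singular_iff clique_def by blast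
    have pts: "c \<in> points G" "\<And>s. s \<in> T' \<Longrightarrow> c \<sim> s" "c \<notin> T'"
      using ocb cS S(1) clique_col[of S] c(2) unfolding opp_def T'_def singular_iff by auto
    have "C \<subseteq> cone c T'"
    proof
      fix y assume y: "y \<in> C"
      show "y \<in> cone c T'"
      proof (cases "y = c")
        case False
        then have yC: "y \<in> C - {c}" using y by blast
        have "c \<sim> y" "c \<noteq> y" using False y CS singular_col[OF S(1) cS] by auto
        moreover have "foot c b y \<noteq> c" using pc[OF yC] c(2) by metis
        ultimately have "y \<in> ln c (foot c b y)" using ln_swap[of c y "foot c b y"] pc[OF yC] by blast
        moreover have "foot c b y \<in> T'" using pc[OF yC] T yC by (auto simp: T'_def B_def)
        ultimately show ?thesis by (auto simp: cone_def)
      qed (simp add: cone_def)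
    qed
    then have "S \<subseteq> cone c T'"
      using C(2) cone_singular[OF T's pts] unfolding generates_def singular_iff by blast
    then have "?H \<subseteq> {x \<in> cone c T'. b \<sim> x}" by blast
    also have "\<dots> = T'" by (rule perp_Int_cone[OF S(2) c(2) pts(2)]) (simp_all add: T'_def)
    finally show "?H \<subseteq> T" by (simp add: T'_def)
  qed
  moreover have "card B < card C"
  proof -
    have "card B \<le> card (C - {c})" unfolding B_def by (rule card_image_le) (use C(1) in simp)
    also have "\<dots> < card C" using C(1) c(1) by (rule card_Diff1_less)
    finally show ?thesis .
  qed
  moreover have "finite B" using C(1) by (simp add: B_def)
  ultimately show ?thesis by blast
qed

lemma has_dimension_hyperplane:
  assumes S: "singular_subspace G S" "b \<in> points G" "p \<in> S" "\<not> b \<sim> p"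
  shows "has_dimension (induced G S) d \<longleftrightarrow> has_dimension (induced G {x \<in> S. b \<sim> x}) (d - 1)"
proof -
  let ?H = "{x \<in> S. b \<sim> x}"
  have sub: "subspace G S" "subspace G ?H"
    using S(1) perp_Int_singular[OF S(1,2)] by (simp_all add: singular_iff)
  show ?thesis unfolding has_dimension_induced[OF sub(1)] has_dimension_induced[OF sub(2)]
  proof (intro iffI; elim exE conjE)
    fix B assume B: "finite B" "generates G B S" "int (card B) = d + 1"
      and min: "\<forall>C. finite C \<and> generates G C S \<longrightarrow> card B \<le> card C"
    have *: "card B \<le> Suc (card C)" if "finite C" "generates G C ?H" for C
    proof -
      have "card B \<le> card (insert p C)" using min generates_insert[OF S that(2)] that(1) by simp
      then show ?thesis using card_insert_le_m1[of "Suc (card C)" C p] by (simp add: card_insert_if that(1) split: if_splits)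
    qed
    obtain B' where B': "finite B'" "generates G B' ?H" "card B' < card B"
      using generates_project[OF S B(1,2)] by blast
    then have "card B = Suc (card B')" using *[OF B'(1,2)] by simp
    then show "\<exists>B. finite B \<and> generates G B ?H \<and> int (card B) = d - 1 + 1 \<and>
      (\<forall>C. finite C \<and> generates G C ?H \<longrightarrow> card B \<le> card C)"
      using B' B(3) * by (intro exI[of _ B']) auto
  next
    fix B assume B: "finite B" "generates G B ?H" "int (card B) = d - 1 + 1"
      and min: "\<forall>C. finite C \<and> generates G C ?H \<longrightarrow> card B \<le> card C"
    have "p \<notin> B" using B(2) S(4) by (auto simp: generates_def)
    then have c: "card (insert p B) = Suc (card B)" using B(1) by simp
    have "card (insert p B) \<le> card C" if "finite C" "generates G C S" for C
      using generates_project[OF S that] min c by fastforce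
    then show "\<exists>B. finite B \<and> generates G B S \<and> int (card B) = d + 1 \<and>
      (\<forall>C. finite C \<and> generates G C S \<longrightarrow> card B \<le> card C)"
      using B c generates_insert[OF S B(2)] by (intro exI[of _ "insert p B"]) auto
  qed
qed

lemma singular_projective:
  assumes S: "singular_subspace G S" shows "projective_space (induced G S)"
  unfolding projective_space_def
proof (intro conjI ballI allI impI)
  have P: "points (induced G S) = S" "l \<in> lines (induced G S) \<longleftrightarrow> l \<in> lines G \<and> l \<subseteq> S" for l
    by (simp_all add: induced_def)
  show "point_line_geometry (induced G S)" by (simp add: point_line_geometry_def induced_def)
  show "at_least_three l" if "l \<in> lines (induced G S)" for l using that line_three P by simp
  show "\<exists>!l. l \<in> lines (induced G S) \<and> x \<in> l \<and> y \<in> l"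
    if "x \<in> points (induced G S)" "y \<in> points (induced G S)" "x \<noteq> y" for x y
  proof -
    have xy: "x \<in> S" "y \<in> S" "x \<sim> y" using that P singular_col[OF S] by simp_all
    show ?thesis
    proof (rule ex1I[of _ "ln x y"])
      show "ln x y \<in> lines (induced G S) \<and> x \<in> ln x y \<and> y \<in> ln x y"
        using singular_ln[OF S xy(1,2) that(3)] ln[OF xy(3) that(3)] P by simp
      show "l = ln x y" if "l \<in> lines (induced G S) \<and> x \<in> l \<and> y \<in> l" for l
        using that ln_eqI[of l x y] \<open>x \<noteq> y\<close> P by simp
    qed
  qed
  fix p q r s l1 l2 m1 m2
  assume l: "l1 \<in> lines (induced G S)" "l2 \<in> lines (induced G S)" "m1 \<in> lines (induced G S)" "m2 \<in> lines (induced G S)"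
    and A: "distinct [p, q, r, s] \<and> {p, q} \<subseteq> l1 \<and> {r, s} \<subseteq> l2 \<and> {p, r} \<subseteq> m1 \<and> {q, s} \<subseteq> m2 \<and> l1 \<inter> l2 \<noteq> {}"
  then have "l1 = ln p q" "l2 = ln r s" "m1 = ln p r" "m2 = ln q s"
    using P ln_eqI[of l1 p q] ln_eqI[of l2 r s] ln_eqI[of m1 p r] ln_eqI[of m2 q s] by auto
  moreover have "{p, q, r, s} \<subseteq> S" using A l(1,2) P(2) by auto
  then have "clique {p, q, r, s}"
    using S clique_subset unfolding singular_iff by blast
  ultimately show "m1 \<inter> m2 \<noteq> {}" using pasch[of p q r s] A by auto
qed

lemma has_dimension_line:
  assumes "x \<sim> y" "x \<noteq> y" shows "has_dimension (induced G (ln x y)) 1"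
proof -
  have S: "singular_subspace G (ln x y)" by (rule line_singular[OF ln_line[OF assms]])
  have sub: "subspace G (ln x y)" using S by (simp add: singular_iff)
  have "generates G {x, y} (ln x y)"
    using subspace_line[of _ "ln x y" x y] ln[OF assms] assms(2) unfolding generates_def by blast
  moreover have "2 \<le> card C" if C: "finite C" "generates G C (ln x y)" for C
  proof (rule ccontr)
    assume "\<not> 2 \<le> card C"
    then have "card C \<le> Suc 0" by simp
    then have c: "u = v" if "u \<in> C" "v \<in> C" for u v using that C(1) by (auto simp: card_le_Suc0_iff_eq)
    have "C \<subseteq> points G" using C(2) line_sub[OF ln_line[OF assms]] unfolding generates_def by blast
    then have "subspace G C" unfolding subspace_def using c by blast
    then have "ln x y \<subseteq> C" using C(2) unfolding generates_def by blast
    then show False using c ln[OF assms] assms(2) by blast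
  qed
  moreover have "card {x, y} = 2" using assms(2) by simp
  ultimately show ?thesis
    unfolding has_dimension_induced[OF sub] by (intro exI[of _ "{x, y}"]) (simp del: card_insert_disjoint)
qed

lemma dimension_one_line:
  assumes S: "singular_subspace G S" "has_dimension (induced G S) 1" and x: "x \<in> S" "y \<in> S" "x \<noteq> y"
  shows "S = ln x y"
proof -
  have sub: "subspace G S" using S by (simp add: singular_iff)
  obtain B where B: "generates G B S" "int (card B) = 1 + 1" using S(2) has_dimension_induced[OF sub] by blast
  then have "card B = 2" by simp
  then obtain u v where uv: "B = {u, v}" "u \<noteq> v" by (auto simp: card_2_iff)
  have "u \<in> S" "v \<in> S" using B(1) uv by (auto simp: generates_def)
  then have c: "u \<sim> v" using singular_col[OF S(1)] by blast
  have "S \<subseteq> ln u v"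
    using B(1) line_singular[OF ln_line[OF c uv(2)]] ln[OF c uv(2)] uv(1) unfolding generates_def singular_iff by blast
  moreover have "ln u v \<subseteq> S" using singular_ln[OF S(1) \<open>u \<in> S\<close> \<open>v \<in> S\<close> uv(2)] .
  ultimately have "S = ln u v" by blast
  then show ?thesis using ln_eqI[OF ln_line[OF c uv(2)] _ _ x(3)] x by simp
qed

lemma dimension_zero_point:
  assumes S: "singular_subspace G S" "has_dimension (induced G S) 0"
  obtains x where "S = {x}"
proof -
  have sub: "subspace G S" using S by (simp add: singular_iff)
  obtain B where B: "generates G B S" "int (card B) = 0 + 1" using S(2) has_dimension_induced[OF sub] by blast
  then obtain u where u: "B = {u}" by (auto simp: card_1_singleton_iff)
  have "u \<in> S" using B(1) u by (simp add: generates_def)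
  then have "subspace G {u}" using sub by (auto simp: subspace_def)
  then have "S \<subseteq> {u}" using B(1) u by (simp add: generates_def)
  then show ?thesis using that \<open>u \<in> S\<close> by blast
qed

lemma dimension_nonneg_nonempty:
  assumes "singular_subspace G S" "has_dimension (induced G S) d" "d \<ge> 0" shows "S \<noteq> {}"
proof
  assume "S = {}"
  have sub: "subspace G S" using assms by (simp add: singular_iff)
  obtain B where "generates G B S" "int (card B) = d + 1" using assms(2) has_dimension_induced[OF sub] by blast
  then show False using \<open>S = {}\<close> assms(3) by (simp add: generates_def)
qed

end

section \<open>Reduction of the rank\<close>

context opposite_points begin

lemma pts: "a \<in> points G" "b \<in> points G" "\<not> a \<sim> b" "\<not> b \<sim> a"
  using ab opp_sym[OF ab] unfolding opp_def by auto

lemma swap: "opposite_points G rk b a"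
  by unfold_locales (rule opp_sym[OF ab])

lemma Q_perp: "Q = perp G a \<inter> perp G b"
  using mem_perp by (auto simp: quad_def)

lemma Q_subspace: "subspace G Q"
  unfolding Q_perp using perp_subspace pts subspace_Int by blast

lemma singular_\<Gamma>: "singular_subspace \<Gamma> T \<longleftrightarrow> singular_subspace G T \<and> T \<subseteq> Q"
  unfolding singular_subspace_def subspace_induced[OF Q_subspace] collinear_\<Gamma> by auto

lemma mem_perp_\<Gamma>: "y \<in> perp \<Gamma> x \<longleftrightarrow> x \<in> Q \<and> y \<in> Q \<and> x \<sim> y"
  by (auto simp: perp_def collinear_\<Gamma> points_\<Gamma>)

lemma ex_not_col_centre:
  assumes x: "x \<in> Q" shows "\<exists>w. a \<sim> w \<and> \<not> x \<sim> w"
proof (rule ccontr)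
  assume "\<not> ?thesis"
  then have H: "x \<sim> w" if "a \<sim> w" for w using that by blast
  obtain w where w: "w \<in> points G" "\<not> x \<sim> w" using ex_not_col Q_pts x by blast
  have xb: "x \<sim> b" "x \<noteq> b" "x \<sim> a" using Q_cols[OF x] quad_neq[OF ab x] by auto
  obtain t where t: "t \<in> ln x b" "w \<sim> t" using perp_meets[OF w(1) ln_line[OF xb(1,2)]] by blast
  have tx: "t \<noteq> x" "x \<sim> t" using t(2) w(2) col_sym ln_col[OF xb(1,2) ln_left[OF xb(1,2)] t(1)] by blast+
  have nat: "\<not> a \<sim> t" using col_ln'[OF col_sym[OF xb(3)] _ xb(1,2) t(1) tx(1)] pts by blast
  have tw: "t \<sim> w" "t \<noteq> w" using t(2) w(2) tx(2) col_sym by blast+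
  obtain s where s: "s \<in> ln t w" "a \<sim> s" using perp_meets[OF pts(1) ln_line[OF tw]] by blast
  have "s \<noteq> t" using s(2) nat by blast
  then have "x \<sim> w" using col_ln'[OF tx(2) H[OF s(2)] tw s(1)] by blast
  then show False using w(2) by blast
qed

lemma ex_not_col_Q:
  assumes x: "x \<in> Q" shows "\<exists>y\<in>Q. \<not> x \<sim> y"
proof -
  obtain w where w: "a \<sim> w" "\<not> x \<sim> w" using ex_not_col_centre[OF x] by blast
  have aw: "a \<noteq> w" using w(2) Q_cols[OF x] by blast
  let ?y = "foot a b w"
  have y: "?y \<in> Q" by (rule foot_quad[OF ab w(1) aw])
  have "\<not> x \<sim> ?y"
    using col_ln'[OF _ _ w(1) aw foot_mem[OF ab w(1) aw], of x] Q_cols[OF x] w(2) quad_neq[OF ab y] by blast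
  then show ?thesis using y by blast
qed

lemma polar_\<Gamma>: "polar_space \<Gamma>"
  unfolding polar_space_def
proof (intro conjI ballI)
  show "point_line_geometry \<Gamma>" by (simp add: point_line_geometry_def induced_def)
  show "at_least_three l" if "l \<in> lines \<Gamma>" for l using that line_three lines_\<Gamma> by blast
  fix x assume "x \<in> points \<Gamma>"
  then have x: "x \<in> Q" by (simp add: points_\<Gamma>)
  have p: "perp \<Gamma> x = Q \<inter> perp G x" using mem_perp_\<Gamma> mem_perp x by auto
  then show "subspace \<Gamma> (perp \<Gamma> x)"
    using subspace_induced[OF Q_subspace] subspace_Int[OF Q_subspace perp_subspace[OF Q_pts[OF x]]] by simp
  show "perp \<Gamma> x \<noteq> points \<Gamma>" using ex_not_col_Q[OF x] p mem_perp points_\<Gamma> by auto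
  show "perp \<Gamma> x \<inter> l \<noteq> {}" if "l \<in> lines \<Gamma>" for l
    using perp_meets[OF Q_pts[OF x], of l] that p mem_perp lines_\<Gamma> by blast
qed

lemma maximal_hyperplane:
  assumes M: "maximal_singular_subspace G M" "a \<in> M"
  shows "maximal_singular_subspace \<Gamma> {x \<in> M. b \<sim> x}" "cone a {x \<in> M. b \<sim> x} = M"
proof -
  have S: "singular_subspace G M" using M(1) by (simp add: maximal_singular_subspace_def)
  let ?H = "{x \<in> M. b \<sim> x}"
  show c: "cone a ?H = M" by (rule cone_hyperplane[OF S pts(2) M(2) pts(4)])
  have "?H \<subseteq> Q" using singular_col[OF S M(2)] by (auto simp: quad_def)
  then have "singular_subspace \<Gamma> ?H" using perp_Int_singular[OF S pts(2)] by (simp add: singular_\<Gamma>)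
  moreover have "T = ?H" if T: "singular_subspace \<Gamma> T" "?H \<subseteq> T" for T
  proof -
    have TG: "singular_subspace G T" "T \<subseteq> Q" using T(1) singular_\<Gamma> by auto
    have "t \<in> M" if "t \<in> T" for t
    proof (rule maximal_closed[OF M(1)])
      show "t \<in> points G" using that TG(2) Q_pts by blast
      fix x assume "x \<in> M"
      then have "x \<in> cone a ?H" using c by simp
      then show "t \<sim> x"
      proof (rule cone_col[rotated -1])
        show "t \<sim> s" if "s \<in> ?H" for s using singular_col[OF TG(1) \<open>t \<in> T\<close>] T(2) that by blast
        show "t \<sim> a" using Q_cols \<open>t \<in> T\<close> TG(2) by blast
        show "a \<sim> s" if "s \<in> ?H" for s using singular_col[OF S M(2)] that by blast
        show "a \<notin> ?H" using pts by blast
      qed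
    qed
    then show ?thesis using T(2) TG(2) Q_cols by blast
  qed
  ultimately show "maximal_singular_subspace \<Gamma> ?H" unfolding maximal_singular_subspace_def by blast
qed

lemma maximal_\<Gamma>_obtain:
  assumes M': "maximal_singular_subspace \<Gamma> M'"
  obtains M where "maximal_singular_subspace G M" "a \<in> M" "M' = {x \<in> M. b \<sim> x}"
proof -
  have S': "singular_subspace G M'" "M' \<subseteq> Q"
    using M' singular_\<Gamma> unfolding maximal_singular_subspace_def by auto
  have "clique (insert a M')"
    using S' Q_cols pts(1) col_refl unfolding singular_iff clique_def by blast
  then obtain M where M: "maximal_singular_subspace G M" "insert a M' \<subseteq> M" using clique_in_maximal by blast
  then have "maximal_singular_subspace \<Gamma> {x \<in> M. b \<sim> x}" using maximal_hyperplane(1) by blast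
  moreover have "M' \<subseteq> {x \<in> M. b \<sim> x}" using M(2) S'(2) Q_cols by blast
  ultimately have "M' = {x \<in> M. b \<sim> x}" using M' unfolding maximal_singular_subspace_def by blast
  then show ?thesis using that M by blast
qed

lemma rank_\<Gamma>:
  assumes "rk \<ge> 1" shows "polar_space_of_rank (rk - 1) \<Gamma>"
  unfolding polar_space_of_rank_def
proof (intro conjI allI impI polar_\<Gamma>)
  fix M' assume M': "maximal_singular_subspace \<Gamma> M'"
  then have S': "singular_subspace G M'" "M' \<subseteq> Q"
    using singular_\<Gamma> unfolding maximal_singular_subspace_def by auto
  have i: "induced \<Gamma> M' = induced G M'" using induced_induced S'(2) by blast
  show "projective_space (induced \<Gamma> M')" using singular_projective[OF S'(1)] i by simp
  obtain M where M: "maximal_singular_subspace G M" "a \<in> M" "M' = {x \<in> M. b \<sim> x}"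
    using maximal_\<Gamma>_obtain[OF M'] .
  have S: "singular_subspace G M" using M(1) by (simp add: maximal_singular_subspace_def)
  have "has_dimension (induced G M) (int rk - 1)" using M(1) rank by (simp add: polar_space_of_rank_def)
  then have "has_dimension (induced G M') (int rk - 1 - 1)"
    using has_dimension_hyperplane[OF S pts(2) M(2) pts(4)] M(3) by simp
  then show "has_dimension (induced \<Gamma> M') (int (rk - 1) - 1)" using i assms by (simp add: of_nat_diff)
qed

lemma thick_\<Gamma>:
  assumes th: "thick_polar_space_of_rank rk G" and "rk \<ge> 1"
  shows "thick_polar_space_of_rank (rk - 1) \<Gamma>"
  unfolding thick_polar_space_of_rank_def
proof (intro conjI allI impI rank_\<Gamma> assms(2))
  fix S' assume A: "singular_subspace \<Gamma> S' \<and> has_dimension (induced \<Gamma> S') (int (rk - 1) - 2)"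
  have S': "singular_subspace G S'" "S' \<subseteq> Q" using A singular_\<Gamma> by auto
  have d: "has_dimension (induced G S') (int rk - 2 - 1)"
    using A induced_induced[OF S'(2)] assms(2) by (simp add: of_nat_diff)
  have p: "a \<sim> s" "b \<sim> s" if "s \<in> S'" for s using Q_cols S'(2) that by blast+
  have an: "a \<notin> S'" using p pts by blast
  have C: "singular_subspace G (cone a S')" by (rule cone_singular[OF S'(1) pts(1) p(1) an])
  have aC: "a \<in> cone a S'" by (simp add: cone_def)
  have H: "{x \<in> cone a S'. b \<sim> x} = S'" by (rule perp_Int_cone[OF pts(2,4) p])
  have "has_dimension (induced G (cone a S')) (int rk - 2)"
    using has_dimension_hyperplane[OF C pts(2) aC pts(4)] d H by simp
  then obtain T where T: "T \<subseteq> {M. maximal_singular_subspace G M \<and> cone a S' \<subseteq> M}" "card T = 3"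
    using th C unfolding thick_polar_space_of_rank_def at_least_three_def by blast
  let ?f = "\<lambda>M. {x \<in> M. b \<sim> x}"
  have aM: "maximal_singular_subspace G M \<and> a \<in> M" if "M \<in> T" for M using that T(1) aC by blast
  have "inj_on ?f T"
  proof (rule inj_onI)
    fix M N assume MN: "M \<in> T" "N \<in> T" "?f M = ?f N"
    then show "M = N" using maximal_hyperplane(2)[of M] maximal_hyperplane(2)[of N] aM by metis
  qed
  then have "card (?f ` T) = 3" using T(2) card_image by metis
  moreover have "?f ` T \<subseteq> {M. maximal_singular_subspace \<Gamma> M \<and> S' \<subseteq> M}"
  proof
    fix N assume "N \<in> ?f ` T"
    then obtain M where M: "M \<in> T" "N = ?f M" by blast
    have "cone a S' \<subseteq> M" using T(1) M(1) by blast
    then have "S' \<subseteq> N" using H M(2) by blast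
    then show "N \<in> {M. maximal_singular_subspace \<Gamma> M \<and> S' \<subseteq> M}"
      using maximal_hyperplane(1) aM[OF M(1)] M(2) by simp
  qed
  ultimately show "at_least_three {M. maximal_singular_subspace \<Gamma> M \<and> S' \<subseteq> M}"
    unfolding at_least_three_def by blast
qed

lemma rank_three_no_triangle:
  assumes "rk = 3" and x: "x \<in> Q" "y \<in> Q" "z \<in> Q" "x \<sim> y" "x \<noteq> y" "z \<sim> x" "z \<sim> y"
  shows "z \<in> ln x y"
proof -
  have r: "polar_space_of_rank 2 \<Gamma>" using rank_\<Gamma> assms(1) by simp
  interpret D: ranked_polar_space \<Gamma> 2 by unfold_locales (rule r)
  have "D.clique {x, y, z}"
    using x col_sym[OF x(4)] col_sym[OF x(6)] col_sym[OF x(7)] col_refl Q_pts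
    unfolding D.clique_def collinear_\<Gamma> points_\<Gamma> by simp
  then obtain M where M: "maximal_singular_subspace \<Gamma> M" "{x, y, z} \<subseteq> M" using D.clique_in_maximal by blast
  then have S: "singular_subspace G M" "M \<subseteq> Q" using singular_\<Gamma> by (auto simp: maximal_singular_subspace_def)
  have "has_dimension (induced \<Gamma> M) 1" using r M(1) by (simp add: polar_space_of_rank_def)
  then have "has_dimension (induced G M) 1" using induced_induced[OF S(2)] by simp
  then have "M = ln x y" using dimension_one_line[OF S(1)] M(2) x(5) by blast
  then show ?thesis using M(2) by simp
qed

lemma plane_through_line:
  assumes "rk = 3" and M: "maximal_singular_subspace G M" "a \<in> M"
    and d: "d \<in> Q" "q \<in> Q" "d \<noteq> q" "d \<in> M" "q \<in> M"
  shows "M = cone a (ln d q)"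
proof -
  have S: "singular_subspace G M" using M(1) by (simp add: maximal_singular_subspace_def)
  let ?H = "{x \<in> M. b \<sim> x}"
  have dq: "d \<sim> q" using singular_col[OF S d(4,5)] .
  have "?H \<subseteq> Q" using singular_col[OF S M(2)] by (auto simp: quad_def)
  then have "?H \<subseteq> ln d q"
    using rank_three_no_triangle[OF assms(1) d(1,2) _ dq d(3)] singular_col[OF S] d(4,5) by blast
  moreover have "ln d q \<subseteq> ?H"
    using singular_ln[OF S d(4,5,3)] ln_sub_Q[OF d(1,2) dq d(3)] Q_cols by blast
  ultimately have "?H = ln d q" by blast
  then show ?thesis using maximal_hyperplane(2)[OF M] by simp
qed

lemma plane_avoiding_centre:
  assumes "rk = 3" and M: "maximal_singular_subspace G M" "a \<notin> M"
    and d: "d \<in> Q" "q \<in> Q" "d \<noteq> q" "d \<in> M" "q \<in> M" and c: "c \<in> M" "c \<notin> ln d q"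
  shows "opp a c"
proof -
  have S: "singular_subspace G M" using M(1) by (simp add: maximal_singular_subspace_def)
  have dq: "d \<sim> q" using singular_col[OF S d(4,5)] .
  have "\<not> a \<sim> c"
  proof
    assume ac: "a \<sim> c"
    have "clique ({a} \<union> {d, q, c})"
      using clique_subset[of M "{d, q, c}"] S d c ac Q_cols[OF d(1)] Q_cols[OF d(2)] col_sym[OF ac]
        col_refl[OF pts(1)] pts(1) unfolding singular_iff clique_def by auto
    then obtain N where N: "maximal_singular_subspace G N" "{a} \<union> {d, q, c} \<subseteq> N" using clique_in_maximal by blast
    then have "c \<in> cone a (ln d q)" using plane_through_line[OF assms(1) N(1) _ d(1-3)] by blast
    moreover have "c \<noteq> a" using M(2) c(1) by blast
    ultimately obtain r where r: "r \<in> ln d q" "c \<in> ln a r" by (auto simp: cone_def)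
    have rM: "r \<in> M" "r \<in> Q" using r(1) singular_ln[OF S d(4,5,3)] ln_sub_Q[OF d(1,2) dq d(3)] by blast+
    have ar: "a \<sim> r" "a \<noteq> r" using Q_cols[OF rM(2)] quad_neq[OF ab rM(2)] by auto
    have cr: "c \<noteq> r" using c(2) r(1) by blast
    have "a \<in> ln r c" using ln_swap[of r a c] ar r(2) cr col_sym ln_sym by metis
    then show False using singular_ln[OF S rM(1) c(1)] cr M(2) by blast
  qed
  moreover have "c \<in> points G" using S c(1) col_pts singular_col by blast
  ultimately show ?thesis using pts(1) by (simp add: opp_def)
qed

lemma rank_three_third_plane:
  assumes rk: "rk = 3" and th: "thick_polar_space_of_rank rk G"
    and d: "d \<in> Q" "q \<in> Q" "n \<in> Q" "d \<sim> q" "d \<noteq> q" "d \<sim> n" "\<not> q \<sim> n"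
  shows "\<exists>c. opp a c \<and> opp b c \<and> d \<sim> c \<and> q \<sim> c \<and> n \<sim> c"
proof -
  interpret sw: opposite_points G rk b a by (rule swap)
  have Q': "d \<in> sw.Q" "q \<in> sw.Q" using d(1,2) quad_sym by simp_all
  have l: "singular_subspace G (ln d q)" by (rule line_singular[OF ln_line[OF d(4,5)]])
  have dq: "d \<in> ln d q" "q \<in> ln d q" using ln[OF d(4,5)] by auto
  obtain T where T: "T \<subseteq> {M. maximal_singular_subspace G M \<and> ln d q \<subseteq> M}" "card T = 3"
    using th l has_dimension_line[OF d(4,5)] rk unfolding thick_polar_space_of_rank_def at_least_three_def by force
  have "card {cone a (ln d q), cone b (ln d q)} \<le> 2" by (simp add: card_insert_if)
  then have "\<not> T \<subseteq> {cone a (ln d q), cone b (ln d q)}"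
    using card_mono[of "{cone a (ln d q), cone b (ln d q)}" T] T(2) by auto
  then obtain M where M: "M \<in> T" "M \<noteq> cone a (ln d q)" "M \<noteq> cone b (ln d q)" by blast
  have mx: "maximal_singular_subspace G M" "ln d q \<subseteq> M" using M(1) T(1) by auto
  have S: "singular_subspace G M" using mx(1) by (simp add: maximal_singular_subspace_def)
  have dM: "d \<in> M" "q \<in> M" using mx(2) dq by auto
  have aM: "a \<notin> M" using plane_through_line[OF rk mx(1) _ d(1,2,5) dM] M(2) by blast
  have bM: "b \<notin> M" using sw.plane_through_line[OF rk mx(1) _ Q' d(5) dM] M(3) by blast
  obtain m where m: "m \<in> M" "m \<notin> ln d q"
  proof (rule ccontr)
    assume "\<not> thesis"
    then have "M \<subseteq> ln d q" using that by blast
    then have "a \<sim> x" if "x \<in> M" for x using that ln_sub_Q[OF d(1,2,4,5)] Q_cols by blast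
    then show False using maximal_closed[OF mx(1) pts(1)] aM by blast
  qed
  have qm: "q \<noteq> m" "q \<sim> m" using m dq(2) singular_col[OF S dM(2) m(1)] by auto
  obtain c where c: "c \<in> ln q m" "n \<sim> c" using perp_meets[OF Q_pts[OF d(3)] ln_line[OF qm(2,1)]] by blast
  have cM: "c \<in> M" using c(1) singular_ln[OF S dM(2) m(1) qm(1)] by blast
  have cq: "c \<noteq> q" using c(2) d(7) col_sym by blast
  have cl: "c \<notin> ln d q"
  proof
    assume "c \<in> ln d q"
    then have "ln q m = ln d q"
      using ln_eqI[OF ln_line[OF d(4,5)] dq(2) _ cq[symmetric]] ln_cong[OF qm(2,1) c(1) cq] by simp
    then show False using m(2) ln_right[OF qm(2,1)] by simp
  qed
  have "opp a c" by (rule plane_avoiding_centre[OF rk mx(1) aM d(1,2,5) dM cM cl])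
  moreover have "opp b c" by (rule sw.plane_avoiding_centre[OF rk mx(1) bM Q' d(5) dM cM cl])
  ultimately show ?thesis using singular_col[OF S _ cM] dM c(2) by blast
qed

lemma rank_three_moufang:
  assumes rk: "rk = 3" and th: "thick_polar_space_of_rank rk G"
  shows "moufang_quadrangle \<Gamma>"
proof -
  interpret thick_residual_quadrangle G rk a b
  proof unfold_locales
    show "z \<in> ln x y" if "x \<in> Q" "y \<in> Q" "z \<in> Q" "x \<sim> y" "x \<noteq> y" "z \<sim> x" "z \<sim> y" for x y z
      by (rule rank_three_no_triangle[OF rk that])
    show "\<exists>c. opp a c \<and> opp b c \<and> d \<sim> c \<and> q \<sim> c \<and> n \<sim> c"
      if "d \<in> Q" "q \<in> Q" "n \<in> Q" "d \<sim> q" "d \<noteq> q" "d \<sim> n" "\<not> q \<sim> n" for d q n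
      by (rule rank_three_third_plane[OF rk th that])
  qed
  have "generalized_quadrangle \<Gamma>" using rank_\<Gamma> rk by (simp add: generalized_quadrangle_def)
  then show ?thesis
    unfolding moufang_quadrangle_def using first_kind_transitive second_kind_transitive by blast
qed

lemma dimension_hyperplane_\<Gamma>:
  assumes U: "singular_subspace G U" "has_dimension (induced G U) d" "a \<in> U"
  shows "singular_subspace \<Gamma> {x \<in> U. b \<sim> x}" "has_dimension (induced \<Gamma> {x \<in> U. b \<sim> x}) (d - 1)"
proof -
  have s: "{x \<in> U. b \<sim> x} \<subseteq> Q" using singular_col[OF U(1,3)] by (auto simp: quad_def)
  then show "singular_subspace \<Gamma> {x \<in> U. b \<sim> x}" using perp_Int_singular[OF U(1) pts(2)] singular_\<Gamma> by blast
  show "has_dimension (induced \<Gamma> {x \<in> U. b \<sim> x}) (d - 1)"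
    using has_dimension_hyperplane[OF U(1) pts(2) U(3) pts(4)] U(2) induced_induced[OF s] by simp
qed

lemma col_hyperplane:
  assumes U: "singular_subspace G U" "a \<in> U" and e: "e \<sim> a" "\<And>x. x \<in> U \<Longrightarrow> b \<sim> x \<Longrightarrow> e \<sim> x" "x \<in> U"
  shows "e \<sim> x"
proof (rule cone_col[of "{x \<in> U. b \<sim> x}" e a x])
  show "x \<in> cone a {x \<in> U. b \<sim> x}" using cone_hyperplane[OF U(1) pts(2) U(2) pts(4)] e(3) by simp
qed (use e singular_col[OF U] pts in blast)+

lemma perp_set_\<Gamma>:
  assumes "X \<subseteq> Q" shows "perp_set \<Gamma> X = {y \<in> Q. \<forall>x\<in>X. x \<sim> y}"
  using assms unfolding perp_set_def points_\<Gamma> mem_perp_\<Gamma> by auto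

lemma perp_set_centres: "perp_set G {a} \<inter> perp_set G {b} = Q"
  using Q_pts by (auto simp: mem_perp_set quad_def)

context
  fixes U V :: "'a set"
  assumes UV: "singular_subspace G U" "singular_subspace G V" "a \<in> U" "b \<in> V" "opposite G U V"
begin

interpretation sw: opposite_points G rk b a by (rule swap)

lemma hyperplane_sub_Q: "{x \<in> U. b \<sim> x} \<subseteq> Q" "{x \<in> V. a \<sim> x} \<subseteq> Q"
  using singular_col[OF UV(1,3)] singular_col[OF UV(2,4)] by (auto simp: quad_def)

lemma opposite_hyperplanes: "opposite \<Gamma> {x \<in> U. b \<sim> x} {x \<in> V. a \<sim> x}"
  unfolding opposite_def collinear_\<Gamma> singular_\<Gamma>
proof (intro conjI hyperplane_sub_Q perp_Int_singular UV pts notI)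
  assume "\<exists>x\<in>{x \<in> U. b \<sim> x}. \<forall>y\<in>{x \<in> V. a \<sim> x}. x \<in> Q \<and> y \<in> Q \<and> x \<sim> y"
  then obtain x where x: "x \<in> U" "b \<sim> x" "\<And>y. y \<in> V \<Longrightarrow> a \<sim> y \<Longrightarrow> x \<sim> y" by blast
  have "x \<sim> y" if "y \<in> V" for y
    by (rule sw.col_hyperplane[OF UV(2,4) col_sym[OF x(2)] _ that]) (rule x(3))
  then show False using UV(5) x(1) by (auto simp: opposite_def)
next
  assume "\<exists>y\<in>{x \<in> V. a \<sim> x}. \<forall>x\<in>{x \<in> U. b \<sim> x}. y \<in> Q \<and> x \<in> Q \<and> y \<sim> x"
  then obtain y where y: "y \<in> V" "a \<sim> y" "\<And>x. x \<in> U \<Longrightarrow> b \<sim> x \<Longrightarrow> y \<sim> x" by blast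
  have "y \<sim> x" if "x \<in> U" for x
    by (rule col_hyperplane[OF UV(1,3) col_sym[OF y(2)] _ that]) (rule y(3))
  then show False using UV(5) y(1) by (auto simp: opposite_def)
qed

lemma perp_set_hyperplanes:
  "perp_set \<Gamma> {x \<in> U. b \<sim> x} \<inter> perp_set \<Gamma> {x \<in> V. a \<sim> x} = perp_set G U \<inter> perp_set G V"
proof (intro equalityI subsetI)
  fix y assume "y \<in> perp_set \<Gamma> {x \<in> U. b \<sim> x} \<inter> perp_set \<Gamma> {x \<in> V. a \<sim> x}"
  then have y: "y \<in> Q" "\<And>x. x \<in> U \<Longrightarrow> b \<sim> x \<Longrightarrow> y \<sim> x" "\<And>x. x \<in> V \<Longrightarrow> a \<sim> x \<Longrightarrow> y \<sim> x"
    using perp_set_\<Gamma>[OF hyperplane_sub_Q(1)] perp_set_\<Gamma>[OF hyperplane_sub_Q(2)] col_sym by blast+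
  note yc = Q_cols[OF y(1)]
  have "x \<sim> y" if "x \<in> U" for x
    by (rule col_sym, rule col_hyperplane[OF UV(1,3) _ _ that]) (use yc y(2) in simp_all)
  moreover have "x \<sim> y" if "x \<in> V" for x
    by (rule col_sym, rule sw.col_hyperplane[OF UV(2,4) _ _ that]) (use yc y(3) in simp_all)
  ultimately show "y \<in> perp_set G U \<inter> perp_set G V" using Q_pts[OF y(1)] mem_perp_set by blast
next
  fix y assume "y \<in> perp_set G U \<inter> perp_set G V"
  then have y: "\<And>x. x \<in> U \<Longrightarrow> x \<sim> y" "\<And>x. x \<in> V \<Longrightarrow> x \<sim> y" using mem_perp_set by blast+
  then have "y \<in> Q" using UV by (simp add: quad_def)
  then show "y \<in> perp_set \<Gamma> {x \<in> U. b \<sim> x} \<inter> perp_set \<Gamma> {x \<in> V. a \<sim> x}"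
    using y perp_set_\<Gamma>[OF hyperplane_sub_Q(1)] perp_set_\<Gamma>[OF hyperplane_sub_Q(2)] by blast
qed

lemma perp_sets_sub_Q: "perp_set G U \<inter> perp_set G V \<subseteq> Q"
  using UV(3,4) mem_perp_set by (auto simp: quad_def)

end

end

theorem corollary4p5:
  fixes \<Delta> :: "'a geometry" and n :: nat and U V :: "'a set"
  assumes "n \<ge> 3"
    and "thick_polar_space_of_rank n \<Delta>"
    and "singular_subspace \<Delta> U" and "has_dimension (induced \<Delta> U) (int n - 3)"
    and "singular_subspace \<Delta> V" and "has_dimension (induced \<Delta> V) (int n - 3)"
    and "opposite \<Delta> U V"
  shows "moufang_quadrangle (induced \<Delta> (perp_set \<Delta> U \<inter> perp_set \<Delta> V))"
  using assms
proof (induction n arbitrary: \<Delta> U V rule: dec_induct)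
  case base
  interpret ranked_polar_space \<Delta> 3
    by unfold_locales (use base(1) in \<open>simp add: thick_polar_space_of_rank_def\<close>)
  obtain a where a: "U = {a}" using dimension_zero_point[OF base(2)] base(3) by auto
  obtain b where b: "V = {b}" using dimension_zero_point[OF base(4)] base(5) by auto
  have "a \<in> points \<Delta>" "b \<in> points \<Delta>"
    using a b base(2,4) by (auto simp: singular_subspace_def subspace_def)
  then interpret opposite_points \<Delta> 3 a b
    by unfold_locales (use base(6) a b in \<open>simp add: opp_def opposite_def\<close>)
  show ?case using rank_three_moufang[OF refl base(1)] unfolding a b perp_set_centres .
next
  case (step n)
  interpret ranked_polar_space \<Delta> "Suc n"
    by unfold_locales (use step.prems(1) in \<open>simp add: thick_polar_space_of_rank_def\<close>)
  have "U \<noteq> {}"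
    by (rule dimension_nonneg_nonempty[OF step.prems(2,3)]) (use step.hyps in simp)
  then obtain a where a: "a \<in> U" by blast
  then obtain b where b: "b \<in> V" "\<not> collinear \<Delta> a b"
    using step.prems(6) by (auto simp: opposite_def)
  have "a \<in> points \<Delta>" "b \<in> points \<Delta>"
    using a b step.prems(2,4) by (auto simp: singular_subspace_def subspace_def)
  then interpret opposite_points \<Delta> "Suc n" a b
    by unfold_locales (use b(2) in \<open>simp add: opp_def\<close>)
  interpret sw: opposite_points \<Delta> "Suc n" b a by (rule swap)
  note hU = dimension_hyperplane_\<Gamma>[OF step.prems(2,3) a]
  note hV = sw.dimension_hyperplane_\<Gamma>[OF step.prems(4,5) b(1), unfolded quad_sym[of b a]]
  note UV = step.prems(2,4) a b(1) step.prems(6)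
  have d: "int (Suc n) - 3 - 1 = int n - 3" by simp
  have "moufang_quadrangle (induced (induced \<Delta> (quad a b)) (perp_set \<Delta> U \<inter> perp_set \<Delta> V))"
    unfolding perp_set_hyperplanes[OF UV, symmetric]
    by (rule step.IH[OF _ hU(1) hU(2)[unfolded d] hV(1) hV(2)[unfolded d] opposite_hyperplanes[OF UV]])
      (use thick_\<Gamma>[OF step.prems(1)] in simp)
  then show ?case unfolding induced_induced[OF perp_sets_sub_Q[OF UV]] .
qed

end
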